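(* Let $n$ be a positive integer and $w\in W^{\mathsf{D}}_n$. Then \[ \mathfrak{S}^{\mathsf{D}}_w(x_i \mapsto q^{i-1}) = \sum_{a=a_1a_2\cdots a_p \in \mathsf{Reduced}^\pm_D(w)} \frac{(q^{|a_1|}+1)(q^{|a_2|}+1)\cdots (q^{|a_p|}+1)}{(q^2-1)(q^{4}-1)\cdots (q^{2p}-1)}\, q^{\operatorname{comaj}_{\mathsf{D}}(a)}, \] where each summand on the right is expanded as a Laurent series in $q^{-1}$.
   Context: Let $x_i$ ($i\in\mathbb{Z}$) be commuting indeterminates. For $1<i<n$ let $r_i=r_{-i}=(i,i+1)(-i,-i-1)$ (permutations of $\mathbb{Z}$), and let $r_1=(1,2)(-1,-2)$, $r_{-1}=(1,-2)(-1,2)$. $W^{\mathsf{D}}_n=\langle r_{-1},r_1,\dots,r_{n-1}\rangle$ is the Coxeter group of permutations $w$ of $\mathbb{Z}$ with $w(i)=i$ for $|i|>n$, $w(-i)=-w(i)$, and an even number of positive $i$ with $w(i)<0$. A signed reduced word for $w$ is a word $a_1\cdots a_p$ with letters in $\{\pm1,\dots,\pm(n-1)\}$ of minimal length with $w=r_{a_1}\cdots r_{a_p}$; $\mathsf{Reduced}^\pm_D(w)$ is the set of these. For a word $a=a_1\cdots a_p$ of integers, a bounded compatible sequence is a weakly increasing integer sequence $\mathbf{i}=(i_1\le\dots\le i_p)$ with $i_j<i_{j+1}$ whenever $a_j\le a_{j+1}$ and $i_j\le a_j$ whenever $0<i_j$; $\mathsf{Compatible}(a)$ is the set of these and $x_{\mathbf{i}}=x_{i_1}\cdots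 x_{i_p}$. Define $\mathfrak{S}^{\mathsf{D}}_w=\sum_{a\in\mathsf{Reduced}^\pm_D(w)}\sum_{\mathbf{i}\in\mathsf{Compatible}(a)}x_{\mathbf{i}}$. $F(x_i\mapsto q^{i-1})$ denotes the Laurent series in $q^{-1}$ obtained by setting $x_i=q^{i-1}$ for all integers $i<n$. For $a=a_1\cdots a_p$ with $a_i\in\{\pm1,\dots,\pm(n-1)\}$, $\operatorname{comaj}_{\mathsf{D}}(a)=|\{i:a_i>0\}|+\sum_{i:\,a_i\prec a_{i+1}}2i$, where $\prec$ is the total order $-1\prec-2\prec\dots\prec-n\prec1\prec2\prec\dots\prec n$. *)

theory Defs
  imports
    "HOL-Analysis.Infinite_Sum"
    "HOL-Computational_Algebra.Formal_Laurent_Series"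
    "HOL-Combinatorics.Transposition"
    "HOL-Library.Multiset"
begin

definition WD :: "nat \<Rightarrow> (int \<Rightarrow> int) set" where
  "WD n = {w. bij w \<and> (\<forall>i. \<bar>i\<bar> > int n \<longrightarrow> w i = i) \<and> (\<forall>i. w (- i) = - w i)
              \<and> even (card {i. i > 0 \<and> w i < 0})}"

definition rD :: "int \<Rightarrow> int \<Rightarrow> int" where
  "rD a = (if a = - 1 then transpose 1 (- 2) \<circ> transpose (- 1) 2
           else transpose \<bar>a\<bar> (\<bar>a\<bar> + 1) \<circ> transpose (- \<bar>a\<bar>) (- \<bar>a\<bar> - 1))"

definition wordD :: "int list \<Rightarrow> int \<Rightarrow> int" where
  "wordD a = foldr (\<lambda>b f. rD b \<circ> f) a id"

definition lettersD :: "nat \<Rightarrow> int set" where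
  "lettersD n = {b. 1 \<le> \<bar>b\<bar> \<and> \<bar>b\<bar> \<le> int n - 1}"

definition reducedD :: "nat \<Rightarrow> (int \<Rightarrow> int) \<Rightarrow> int list set" where
  "reducedD n w = {a \<in> lists (lettersD n). wordD a = w \<and>
      (\<forall>b \<in> lists (lettersD n). wordD b = w \<longrightarrow> length a \<le> length b)}"

definition compatible :: "int list \<Rightarrow> int list set" where
  "compatible a = {s. length s = length a \<and> sorted s \<and>
      (\<forall>j. Suc j < length a \<longrightarrow> a ! j \<le> a ! Suc j \<longrightarrow> s ! j < s ! Suc j) \<and>
      (\<forall>j < length a. 0 < s ! j \<longrightarrow> s ! j \<le> a ! j)}"

(* A monomial in the commuting indeterminates x_i (i an integer) is the multiset of its
   indices, so x_s is mset s.  A formal power series is its coefficient function on monomials. *)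
type_synonym power_series = "int multiset \<Rightarrow> int"

definition schubertD :: "nat \<Rightarrow> (int \<Rightarrow> int) \<Rightarrow> power_series" where
  "schubertD n w = (\<lambda>m. \<Sum>a\<in>reducedD n w. int (card {s \<in> compatible a. mset s = m}))"

(* Laurent series in 1/q are rendered as formal Laurent series whose variable is 1/q. *)
abbreviation q :: "rat fls" where
  "q \<equiv> fls_X_inv"

(* Substituting v i for x_i in F converges, with value L, in the usual topology on
   formal Laurent series (unordered summation over all monomials). *)
definition specializes_to :: "power_series \<Rightarrow> (int \<Rightarrow> rat fls) \<Rightarrow> rat fls \<Rightarrow> bool" where
  "specializes_to F v L \<longleftrightarrow> ((\<lambda>m. of_int (F m) * (\<Prod>i\<in>#m. v i)) has_sum L) UNIV"

definition precD :: "int \<Rightarrow> int \<Rightarrow> bool" where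
  "precD a b \<longleftrightarrow> (a < 0 \<and> 0 < b) \<or> (sgn a = sgn b \<and> \<bar>a\<bar> < \<bar>b\<bar>)"

(* List positions start at 0, hence the weight 2 * (j + 1). *)
definition comajD :: "int list \<Rightarrow> nat" where
  "comajD a = card {j. j < length a \<and> 0 < a ! j}
            + (\<Sum>j | Suc j < length a \<and> precD (a ! j) (a ! Suc j). 2 * (j + 1))"

end

(* In the nilCoxeter algebra with generators u_b let h_b(x) = 1 + x u_b, so that
   h_b(x) h_b(y) = h_b(x + y) and h_b(x) h_c(x + y) h_b(y) = h_c(y) h_b(x + y) h_c(x) for a braid
   pair b, c.  The generating function of all signed reduced words with compatible sequences is
   ... C(x_{-1}) C(x_0) A_1(x_1) ... A_{n-1}(x_{n-1}), where A_k(x) = h_{n-1}(x) ... h_k(x) and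
   C(x) = h_{n-1}(x) ... h_1(x) h_{-1}(x) ... h_{1-n}(x).  The Yang-Baxter relation gives
   h_1(y) ... h_{n-1}(y) A_1(x_1) ... A_{n-1}(x_{n-1})
     = A_2(x_1) ... A_{n-1}(x_{n-2}) h_1(x_1 + y) ... h_{n-1}(x_{n-1} + y),
   so that, up to exchanging u_1 and u_{-1}, the product is the one with all indices lowered by 1
   times h_1(x_1 + x_0) ... h_{n-1}(x_{n-1} + x_0).  Two such steps with x_i = q^(i-1) express the
   series F through F with all x_i divided by q^2.  The coefficient of a word of length p then
   shrinks by q^(-2p), so this recursion has only one solution with constant term 1, and a
   telescoping sum over the last ascending run of a word shows that the right-hand side is one. *)
theory Submission
  imports Defs "HOL-Library.Sublist"
begin

section \<open>Products in the nilCoxeter algebra\<close>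

text \<open>A linear combination of words is its coefficient function; \<open>suffix_part c\<close> is right
  multiplication by the word \<open>c\<close>.  A product of factors \<open>1 + x u\<^sub>b\<close> is the list of its pairs
  \<open>(b, x)\<close>.\<close>

definition suffix_part :: "int list \<Rightarrow> (int list \<Rightarrow> 'a::comm_ring_1) \<Rightarrow> int list \<Rightarrow> 'a" where
  "suffix_part c \<psi> a = (if suffix c a then \<psi> (take (length a - length c) a) else 0)"

definition mult_factor :: "(int list \<Rightarrow> 'a::comm_ring_1) \<Rightarrow> int \<times> 'a \<Rightarrow> int list \<Rightarrow> 'a" where
  "mult_factor \<psi> h a = \<psi> a + snd h * suffix_part [fst h] \<psi> a"

abbreviation mult_factors where "mult_factors \<equiv> foldl mult_factor"

definition red_sum :: "nat \<Rightarrow> (int list \<Rightarrow> 'a::comm_ring_1) \<Rightarrow> (int \<Rightarrow> int) \<Rightarrow> 'a" where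
  "red_sum n \<psi> w = (\<Sum>a\<in>reducedD n w. \<psi> a)"

lemma suffix_part_append [simp]: "suffix_part c \<psi> (a @ c) = \<psi> a"
  by (simp add: suffix_part_def suffix_def)

lemma suffix_part_zero: "(\<And>d. a \<noteq> d @ c) \<Longrightarrow> suffix_part c \<psi> a = 0"
  by (auto simp: suffix_part_def suffix_def)

lemma suffix_part_add: "suffix_part c (\<lambda>a. f a + g a) = (\<lambda>a. suffix_part c f a + suffix_part c g a)"
  by (auto simp: suffix_part_def)

lemma suffix_part_cmult: "suffix_part c (\<lambda>a. x * f a) = (\<lambda>a. x * suffix_part c f a)"
  by (auto simp: suffix_part_def)

lemma suffix_part_suffix_part:
  "suffix_part c (suffix_part d \<psi>) = suffix_part (d @ c) \<psi>"
proof
  fix a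
  \<comment> \<open>In the last two cases both sides vanish: in (2) the word ends in
    \<open>c\<close> but the rest does not end in \<open>d\<close>, in (3) it does not end in
    \<open>c\<close> at all.\<close>
  consider (1) e where "a = e @ d @ c" | (2) e where "a = e @ c" "\<And>f. e \<noteq> f @ d" | (3) "\<And>e. a \<noteq> e @ c"
  proof (cases "\<exists>e. a = e @ c")
    case True
    then obtain e where e: "a = e @ c" by blast
    then show ?thesis using that(1,2) by (cases "\<exists>f. e = f @ d") auto
  qed (use that(3) in blast)
  then show "suffix_part c (suffix_part d \<psi>) a = suffix_part (d @ c) \<psi> a"
  proof cases
    case 1
    have "suffix_part c (suffix_part d \<psi>) ((e @ d) @ c) = \<psi> e"
      by (simp only: suffix_part_append)
    moreover have "suffix_part (d @ c) \<psi> (e @ (d @ c)) = \<psi> e"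
      by (simp only: suffix_part_append)
    ultimately show ?thesis by (simp add: 1)
  next
    case 2
    then have "suffix_part d \<psi> e = 0" "\<And>f. a \<noteq> f @ d @ c"
      by (auto intro: suffix_part_zero)
    then show ?thesis using 2(1) by (simp add: suffix_part_zero)
  next
    case 3
    then have "a \<noteq> f @ d @ c" for f
      by (metis append_assoc)
    then show ?thesis using 3 by (simp add: suffix_part_zero)
  qed
qed

section \<open>The generators and their signed reduced words\<close>

lemma wordD_simps [simp]: "wordD [] = id" "wordD (b # a) = rD b \<circ> wordD a"
  by (simp_all add: wordD_def)

lemma wordD_append: "wordD (a @ b) = wordD a \<circ> wordD b"
  by (induction a) (simp_all add: comp_assoc)

lemma rD_pos:
  assumes "b > 0"
  shows "rD b x = (if x = b then b + 1 else if x = b + 1 then b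
                   else if x = - b then - b - 1 else if x = - b - 1 then - b else x)"
  using assms by (auto simp: rD_def transpose_def)

lemma rD_m1: "rD (- 1) x = (if x = 1 then - 2 else if x = - 2 then 1
                   else if x = - 1 then 2 else if x = 2 then - 1 else x)"
  by (auto simp: rD_def transpose_def)

text \<open>\<open>rD\<close> reads a letter other than \<open>- 1\<close> through its absolute
  value only. This is the source of the signs in signed reduced words: a generator of index at least
  2 has two names.\<close>

lemma rD_uminus: "\<bar>b\<bar> \<noteq> 1 \<Longrightarrow> rD (- b) = rD b"
  by (auto simp: rD_def)

text \<open>The letter 0 has to be excluded: there the two transpositions share the point 0 and
  \<open>rD 0\<close> is a 3-cycle.\<close>

lemma rD_invol: "b \<noteq> 0 \<Longrightarrow> rD b \<circ> rD b = id"
proof -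
  have pos: "b > 0 \<Longrightarrow> rD b \<circ> rD b = id" for b
    by (rule ext) (auto simp: rD_pos)
  have m1: "rD (- 1) \<circ> rD (- 1) = id"
    by (rule ext) (auto simp: rD_m1)
  assume "b \<noteq> 0"
  then consider "b > 0" | "b = - 1" | "b < - 1" by linarith
  then show ?thesis
    by cases (use pos[of b] pos[of "- b"] m1 rD_uminus[of b] in auto)
qed

lemma finite_lettersD: "finite (lettersD n)"
  by (rule finite_subset[of _ "{- int n..int n}"]) (auto simp: lettersD_def)

lemma length_reducedD: "a \<in> reducedD n w \<Longrightarrow> b \<in> reducedD n w \<Longrightarrow> length a = length b"
  unfolding reducedD_def by (metis (no_types, lifting) mem_Collect_eq order.antisym)

lemma finite_reducedD: "finite (reducedD n w)"
proof (cases "reducedD n w = {}")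
  case False
  then obtain a where a: "a \<in> reducedD n w" by blast
  have "reducedD n w \<subseteq> {b. set b \<subseteq> lettersD n \<and> length b = length a}"
  proof
    fix b assume "b \<in> reducedD n w"
    then show "b \<in> {b. set b \<subseteq> lettersD n \<and> length b = length a}"
      using length_reducedD[OF a, of b] by (auto simp: reducedD_def)
  qed
  then show ?thesis by (rule finite_subset) (simp add: finite_lettersD finite_lists_length_eq)
qed auto

text \<open>Minimality sees a final segment only through its permutation, its length and the
  admissibility of its letters. Commutations, braid moves and sign changes are all
  instances.\<close>

lemma reducedD_append_cong:
  assumes "wordD c = wordD d" "length c = length d" "c \<in> lists (lettersD n) \<longleftrightarrow> d \<in> lists (lettersD n)"
  shows "a @ c \<in> reducedD n w \<longleftrightarrow> a @ d \<in> reducedD n w"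
  using assms by (simp add: reducedD_def wordD_append)

text \<open>Cancelling the two letters leaves a shorter word for the same permutation. This becomes
  the relation \<open>u_b u_b = 0\<close>.\<close>

lemma reducedD_no_square: "a @ [b, b] \<notin> reducedD n w"
proof
  assume *: "a @ [b, b] \<in> reducedD n w"
  then have "b \<noteq> 0" "a \<in> lists (lettersD n)" by (auto simp: reducedD_def lettersD_def)
  moreover from this have "wordD (a @ [b, b]) = wordD a" by (simp add: wordD_append rD_invol)
  ultimately have "length (a @ [b, b]) \<le> length a" using * by (simp add: reducedD_def)
  then show False by simp
qed

text \<open>The word \<open>d\<close> certifies that multiplication by \<open>rD b\<close> lowers
  the minimal length by exactly one, so adding or removing a final \<open>b\<close> preserves
  minimality.\<close>

lemma reducedD_snoc:
  assumes "d @ [b] \<in> reducedD n w"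
  shows "a @ [b] \<in> reducedD n w \<longleftrightarrow> a \<in> reducedD n (w \<circ> rD b)"
proof -
  have b: "b \<in> lettersD n" "b \<noteq> 0" using assms by (auto simp: reducedD_def lettersD_def)
  have eq: "wordD (e @ [b]) = w \<longleftrightarrow> wordD e = w \<circ> rD b" for e
    using rD_invol[OF b(2)] by (metis comp_assoc comp_id wordD_append wordD_simps)
  show ?thesis
  proof
    assume a: "a @ [b] \<in> reducedD n w"
    have "length a \<le> length e" if "e \<in> lists (lettersD n)" "wordD e = w \<circ> rD b" for e
    proof -
      have "e @ [b] \<in> lists (lettersD n)" "wordD (e @ [b]) = w" using that b eq by auto
      then have "length (a @ [b]) \<le> length (e @ [b])" using a unfolding reducedD_def by blast
      then show ?thesis by simp
    qed
    then show "a \<in> reducedD n (w \<circ> rD b)" using a eq by (auto simp: reducedD_def)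
  next
    assume a: "a \<in> reducedD n (w \<circ> rD b)"
    \<comment> \<open>\<open>d\<close> is also a word for \<open>w \<circ> rD b\<close>, and
      \<open>a\<close> is minimal there. Since \<open>d @ [b]\<close> is minimal for
      \<open>w\<close>, so is \<open>a @ [b]\<close>.\<close>
    have "length a \<le> length d" using a assms eq by (auto simp: reducedD_def)
    moreover have "length (d @ [b]) \<le> length e" if "e \<in> lists (lettersD n)" "wordD e = w" for e
      using assms that unfolding reducedD_def by blast
    ultimately have "length (a @ [b]) \<le> length e" if "e \<in> lists (lettersD n)" "wordD e = w" for e
      using that by fastforce
    then show "a @ [b] \<in> reducedD n w" using a b eq by (auto simp: reducedD_def)
  qed
qed

section \<open>Sums over the reduced words of one permutation\<close>

lemma red_sum_add: "red_sum n (\<lambda>a. f a + g a) = (\<lambda>w. red_sum n f w + red_sum n g w)"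
  by (auto simp: red_sum_def sum.distrib)

lemma red_sum_cmult: "red_sum n (\<lambda>a. x * f a) = (\<lambda>w. x * red_sum n f w)"
  by (auto simp: red_sum_def sum_distrib_left)

lemma red_sum_suffix_part:
  "red_sum n (suffix_part c \<psi>) w = (\<Sum>a | a @ c \<in> reducedD n w. \<psi> a)"
proof -
  have "red_sum n (suffix_part c \<psi>) w = (\<Sum>a\<in>(\<lambda>a. a @ c) ` {a. a @ c \<in> reducedD n w}. suffix_part c \<psi> a)"
    unfolding red_sum_def
    by (rule sum.mono_neutral_right) (auto simp: finite_reducedD intro!: suffix_part_zero)
  also have "\<dots> = (\<Sum>a | a @ c \<in> reducedD n w. \<psi> a)"
    by (subst sum.reindex) (auto simp: inj_on_def)
  finally show ?thesis .
qed

lemma red_sum_suffix_part_cong: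
  assumes "wordD c = wordD d" "length c = length d" "c \<in> lists (lettersD n) \<longleftrightarrow> d \<in> lists (lettersD n)"
  shows "red_sum n (suffix_part c \<psi>) = red_sum n (suffix_part d \<psi>)"
  using reducedD_append_cong[OF assms] by (auto simp: red_sum_suffix_part)

lemma red_sum_suffix_part_square: "red_sum n (suffix_part [b, b] \<psi>) = (\<lambda>_. 0)"
  by (auto simp: red_sum_suffix_part reducedD_no_square)

text \<open>By \<open>reducedD_snoc\<close>, right multiplication by a generator acts on the values
  of \<open>red_sum n \<psi>\<close> themselves, with no finer information on \<psi>. This makes
  \<open>nil_eqv\<close> stable under further factors.\<close>

lemma red_sum_suffix_part_single:
  "red_sum n (suffix_part [b] \<psi>) w =
     (if \<exists>a. a @ [b] \<in> reducedD n w then red_sum n \<psi> (w \<circ> rD b) else 0)"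
proof (cases "\<exists>a. a @ [b] \<in> reducedD n w")
  case True
  then have "{a. a @ [b] \<in> reducedD n w} = reducedD n (w \<circ> rD b)"
    using reducedD_snoc by blast
  then have "red_sum n (suffix_part [b] \<psi>) w = red_sum n \<psi> (w \<circ> rD b)"
    unfolding red_sum_suffix_part unfolding red_sum_def by (rule arg_cong)
  then show ?thesis
    unfolding if_P[OF True] .
next
  case False
  then have "{a. a @ [b] \<in> reducedD n w} = {}" by blast
  then show ?thesis
    unfolding if_not_P[OF False] red_sum_suffix_part by (simp only: sum.empty)
qed

lemma mult_factor_fun: "mult_factor \<psi> h = (\<lambda>a. \<psi> a + snd h * suffix_part [fst h] \<psi> a)"
  by (simp add: fun_eq_iff mult_factor_def)

lemma mult_factors_snoc:
  "mult_factors \<psi> (L @ [(b, x)]) a = mult_factors \<psi> L a + x * suffix_part [b] (mult_factors \<psi> L) a"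
  unfolding foldl_append foldl.simps by (simp only: mult_factor_def fst_conv snd_conv)

lemma red_sum_mult_factor:
  "red_sum n (mult_factor \<psi> (b, x)) w =
     red_sum n \<psi> w + x * (if \<exists>a. a @ [b] \<in> reducedD n w then red_sum n \<psi> (w \<circ> rD b) else 0)"
  by (simp only: mult_factor_fun red_sum_add red_sum_cmult red_sum_suffix_part_single fst_conv snd_conv)

lemma red_sum_mult_factors_cong:
  assumes "red_sum n \<psi> = red_sum n \<phi>"
  shows "red_sum n (mult_factors \<psi> L) = red_sum n (mult_factors \<phi> L)"
proof (induction L rule: rev_induct)
  case (snoc h L)
  then show ?case
    by (cases h) (simp add: red_sum_mult_factor fun_eq_iff)
qed (use assms in simp)

text \<open>Equality of two products in the nilCoxeter algebra.  Only sums over reduced words are compared,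
  so the relations follow from the definition of \<^const>\<open>reducedD\<close> alone, without any length
  formula.\<close>

definition nil_eqv :: "nat \<Rightarrow> (int \<times> 'a::comm_ring_1) list \<Rightarrow> (int \<times> 'a) list \<Rightarrow> bool" where
  "nil_eqv n L L' \<longleftrightarrow> (\<forall>\<psi>. red_sum n (mult_factors \<psi> L) = red_sum n (mult_factors \<psi> L'))"

lemma nil_eqv_refl [simp]: "nil_eqv n L L"
  by (simp add: nil_eqv_def)

lemma nil_eqv_sym: "nil_eqv n L M \<Longrightarrow> nil_eqv n M L"
  by (simp add: nil_eqv_def)

lemma nil_eqv_trans [trans]: "nil_eqv n L M \<Longrightarrow> nil_eqv n M N \<Longrightarrow> nil_eqv n L N"
  by (simp add: nil_eqv_def)

lemma nil_eqv_eq_trans [trans]: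
  "nil_eqv n L M \<Longrightarrow> M = N \<Longrightarrow> nil_eqv n L N" "L = M \<Longrightarrow> nil_eqv n M N \<Longrightarrow> nil_eqv n L N"
  by simp_all

text \<open>The left part can be exchanged because later factors see only the \<open>red_sum\<close>
  of what precedes them, the right part because \<open>nil_eqv\<close> admits every initial
  combination \<psi>.\<close>

lemma nil_eqv_append: "nil_eqv n L L' \<Longrightarrow> nil_eqv n M M' \<Longrightarrow> nil_eqv n (L @ M) (L' @ M')"
  unfolding nil_eqv_def foldl_append
proof
  fix \<psi> :: "int list \<Rightarrow> 'a"
  assume L: "\<forall>\<psi>. red_sum n (mult_factors \<psi> L) = red_sum n (mult_factors \<psi> L')"
    and M: "\<forall>\<psi>. red_sum n (mult_factors \<psi> M) = red_sum n (mult_factors \<psi> M')"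
  show "red_sum n (mult_factors (mult_factors \<psi> L) M) = red_sum n (mult_factors (mult_factors \<psi> L') M')"
    using red_sum_mult_factors_cong[OF L[rule_format], of \<psi> M] M by simp
qed

lemmas mult_expand = mult_factor_fun suffix_part_add suffix_part_cmult
  suffix_part_suffix_part red_sum_add red_sum_cmult

text \<open>The cross term carries \<open>u_b u_b\<close>, which yields no reduced word.\<close>

lemma nil_eqv_add: "nil_eqv n [(b, x), (b, y)] [(b, x + y)]"
  by (simp add: nil_eqv_def mult_expand red_sum_suffix_part_square algebra_simps)

lemma nil_eqv_commute:
  assumes "rD b \<circ> rD c = rD c \<circ> rD b"
  shows "nil_eqv n [(b, x), (c, y)] [(c, y), (b, x)]"
proof -
  have "red_sum n (suffix_part [b, c] \<psi>) = red_sum n (suffix_part [c, b] \<psi>)"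
    for \<psi> :: "int list \<Rightarrow> 'a"
    by (rule red_sum_suffix_part_cong) (use assms in auto)
  then show ?thesis by (simp add: nil_eqv_def mult_expand algebra_simps)
qed

text \<open>Once squares drop out, both expansions have the coefficient \<open>x + y\<close> at each
  generator, \<open>x (x + y)\<close> at \<open>u_b u_c\<close> and \<open>y (x + y)\<close> at
  \<open>u_c u_b\<close>. The cubic terms, both with coefficient \<open>x y (x + y)\<close>, are
  identified by the braid relation.\<close>

lemma nil_eqv_Yang_Baxter:
  assumes "rD b \<circ> rD c \<circ> rD b = rD c \<circ> rD b \<circ> rD c"
  shows "nil_eqv n [(b, x), (c, x + y), (b, y)] [(c, y), (b, x + y), (c, x)]"
proof -
  have "red_sum n (suffix_part [b, c, b] \<psi>) = red_sum n (suffix_part [c, b, c] \<psi>)"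
    for \<psi> :: "int list \<Rightarrow> 'a"
    by (rule red_sum_suffix_part_cong) (use assms in \<open>auto simp: comp_assoc\<close>)
  then show ?thesis
    by (simp add: nil_eqv_def mult_expand red_sum_suffix_part_square algebra_simps)
qed

text \<open>The coefficients differ word by word, but not after summation over reduced words: both
  letters name one generator and the alphabet is closed under negation.\<close>

lemma nil_eqv_uminus:
  assumes "\<bar>b\<bar> \<noteq> 1"
  shows "nil_eqv n [(- b, x)] [(b, x)]"
proof -
  have "red_sum n (suffix_part [- b] \<psi>) = red_sum n (suffix_part [b] \<psi>)"
    for \<psi> :: "int list \<Rightarrow> 'a"
    by (rule red_sum_suffix_part_cong) (use assms in \<open>auto simp: rD_uminus lettersD_def\<close>)
  then show ?thesis
    by (simp add: nil_eqv_def mult_expand)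
qed

section \<open>Moving a factor through the staircase\<close>

text \<open>The letters \<open>fork e 1, fork e 2, \<dots>\<close> run along one of the two type A branches of the Dynkin
  diagram.\<close>

definition fork :: "int \<Rightarrow> int \<Rightarrow> int" where
  "fork e b = (if b = 1 then e else b)"

text \<open>For \<open>e = 1\<close> this is the product \<open>A_k(x)\<close>; for
  \<open>e = - 1\<close> the letter \<open>- 1\<close> replaces 1. From \<open>k = 2\<close> on the
  sign has no effect.\<close>

definition down :: "nat \<Rightarrow> int \<Rightarrow> int \<Rightarrow> 'a \<Rightarrow> (int \<times> 'a) list" where
  "down n e k x = map (\<lambda>b. (fork e b, x)) (rev [k..int n - 1])"

definition up :: "nat \<Rightarrow> int \<Rightarrow> int \<Rightarrow> 'a \<Rightarrow> (int \<times> 'a) list" where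
  "up n e k x = map (\<lambda>b. (fork e b, x)) [k..int n - 1]"

lemma nil_eqv_congs: "nil_eqv n L L' \<Longrightarrow> nil_eqv n (A @ L @ B) (A @ L' @ B)"
  by (intro nil_eqv_append) auto

lemma nil_eqv_map:
  assumes "\<And>b. b \<in> set bs \<Longrightarrow> nil_eqv n [f b] [g b]"
  shows "nil_eqv n (map f bs) (map g bs)"
  using assms
proof (induction bs)
  case (Cons b bs)
  then have "nil_eqv n ([f b] @ map f bs) ([g b] @ map g bs)"
    by (intro nil_eqv_append) auto
  then show ?case by simp
qed auto

lemma nil_eqv_commute_list:
  assumes "\<And>h. h \<in> set L \<Longrightarrow> rD b \<circ> rD (fst h) = rD (fst h) \<circ> rD b"
  shows "nil_eqv n ((b, x) # L) (L @ [(b, x)])"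
  using assms
proof (induction L)
  case (Cons h L)
  have "nil_eqv n [(b, x), h] [h, (b, x)]"
    using nil_eqv_commute[OF Cons.prems[of h], of n x "snd h"] by simp
  then have "nil_eqv n ([(b, x), h] @ L) ([h, (b, x)] @ L)"
    by (rule nil_eqv_append) simp
  then have "nil_eqv n ((b, x) # h # L) ([h] @ ((b, x) # L))" by simp
  also have "nil_eqv n ([h] @ ((b, x) # L)) ([h] @ (L @ [(b, x)]))"
    using Cons by (intro nil_eqv_append nil_eqv_refl) auto
  finally show ?case by simp
qed auto

section \<open>Commutation and braid relations between the generators\<close>

lemma rD_outside:
  assumes "\<bar>x\<bar> \<notin> {\<bar>a\<bar>, \<bar>a\<bar> + 1}"
  shows "rD a x = x"
proof -
  have "x \<noteq> \<bar>a\<bar>" "x \<noteq> \<bar>a\<bar> + 1" "x \<noteq> - \<bar>a\<bar>" "x \<noteq> - \<bar>a\<bar> - 1"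
    using assms by auto
  then show ?thesis by (cases "a = - 1") (simp_all add: rD_def transpose_def)
qed

lemma rD_inside:
  assumes "\<bar>x\<bar> \<in> {\<bar>a\<bar>, \<bar>a\<bar> + 1}"
  shows "\<bar>rD a x\<bar> \<in> {\<bar>a\<bar>, \<bar>a\<bar> + 1}"
proof (cases "a = - 1")
  case False
  have "x = \<bar>a\<bar> \<or> x = - \<bar>a\<bar> \<or> x = \<bar>a\<bar> + 1 \<or> x = - \<bar>a\<bar> - 1"
    using assms by auto
  then have "rD a x \<in> {\<bar>a\<bar>, - \<bar>a\<bar>, \<bar>a\<bar> + 1, - \<bar>a\<bar> - 1}"
    using False by (elim disjE) (simp_all add: rD_def transpose_def)
  then show ?thesis by auto
qed (use assms in \<open>auto simp: rD_m1\<close>)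

text \<open>The two generators move points from disjoint sets of absolute values, and each maps its
  own set into itself.\<close>

lemma rD_commute:
  assumes "\<bar>b\<bar> + 2 \<le> \<bar>c\<bar>"
  shows "rD b \<circ> rD c = rD c \<circ> rD b"
proof
  fix x
  consider "\<bar>x\<bar> \<in> {\<bar>b\<bar>, \<bar>b\<bar> + 1}" | "\<bar>x\<bar> \<in> {\<bar>c\<bar>, \<bar>c\<bar> + 1}"
    | "\<bar>x\<bar> \<notin> {\<bar>b\<bar>, \<bar>b\<bar> + 1}" "\<bar>x\<bar> \<notin> {\<bar>c\<bar>, \<bar>c\<bar> + 1}" by blast
  then show "(rD b \<circ> rD c) x = (rD c \<circ> rD b) x"
  proof cases
    case 1
    then have "rD c x = x" "rD c (rD b x) = rD b x"
      using rD_inside[OF 1] assms by (auto intro!: rD_outside)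
    then show ?thesis by simp
  next
    case 2
    then have "rD b x = x" "rD b (rD c x) = rD c x"
      using rD_inside[OF 2] assms by (auto intro!: rD_outside)
    then show ?thesis by simp
  next
    case 3
    then show ?thesis by (simp add: rD_outside)
  qed
qed

lemma rD_fork_commute:
  assumes "1 \<le> b" "b + 2 \<le> c" "e \<in> {1, - 1}"
  shows "rD (fork e b) \<circ> rD (fork e' c) = rD (fork e' c) \<circ> rD (fork e b)"
  by (rule rD_commute) (use assms in \<open>auto simp: fork_def\<close>)

text \<open>A computation on the six points that the two generators can move; all others are fixed
  by both.\<close>

lemma rD_braid:
  assumes "1 \<le> b"
  shows "rD b \<circ> rD (b + 1) \<circ> rD b = rD (b + 1) \<circ> rD b \<circ> rD (b + 1)"
proof
  fix x
  have b: "rD b b = b + 1" "rD b (b + 1) = b" "rD b (- b) = - b - 1" "rD b (- b - 1) = - b"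
    "rD b (b + 2) = b + 2" "rD b (- b - 2) = - b - 2"
    and c: "rD (b + 1) b = b" "rD (b + 1) (b + 1) = b + 2" "rD (b + 1) (b + 2) = b + 1"
    "rD (b + 1) (- b) = - b" "rD (b + 1) (- b - 1) = - b - 2" "rD (b + 1) (- b - 2) = - b - 1"
    using assms by (simp_all add: rD_pos)
  consider "x \<in> {b, b + 1, b + 2, - b, - b - 1, - b - 2}" | "rD b x = x" "rD (b + 1) x = x"
  proof (cases "x \<in> {b, b + 1, b + 2, - b, - b - 1, - b - 2}")
    case False
    have "rD b x = x" "rD (b + 1) x = x"
      by (rule rD_outside; use assms False in simp; linarith)+
    then show ?thesis by (rule that(2))
  qed (rule that(1))
  then show "(rD b \<circ> rD (b + 1) \<circ> rD b) x = (rD (b + 1) \<circ> rD b \<circ> rD (b + 1)) x"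
    unfolding comp_def by cases (auto simp only: b c insert_iff empty_iff)
qed

lemma rD_m1_braid: "rD (- 1) \<circ> rD 2 \<circ> rD (- 1) = rD 2 \<circ> rD (- 1) \<circ> rD 2"
proof
  fix x :: int
  have b: "rD (- 1) 1 = - 2" "rD (- 1) 2 = - 1" "rD (- 1) (- 1) = 2" "rD (- 1) (- 2) = 1"
    "rD (- 1) 3 = 3" "rD (- 1) (- 3) = - 3"
    and c: "rD 2 1 = 1" "rD 2 2 = 3" "rD 2 3 = 2" "rD 2 (- 1) = - 1" "rD 2 (- 2) = - 3" "rD 2 (- 3) = - 2"
    by (simp_all add: rD_pos rD_m1)
  consider "x \<in> {1, 2, 3, - 1, - 2, - 3}" | "rD (- 1) x = x" "rD 2 x = x"
  proof (cases "x \<in> {1, 2, 3, - 1, - 2, - 3}")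
    case False
    have "rD (- 1) x = x" "rD 2 x = x"
      by (rule rD_outside; use False in simp; linarith)+
    then show ?thesis by (rule that(2))
  qed (rule that(1))
  then show "(rD (- 1) \<circ> rD 2 \<circ> rD (- 1)) x = (rD 2 \<circ> rD (- 1) \<circ> rD 2) x"
    unfolding comp_def by cases (auto simp only: b c insert_iff empty_iff)
qed

text \<open>Both 1 and \<open>- 1\<close> form a braid pair with 2, so either branch of the fork is
  a type A chain and one argument serves both signs.\<close>

lemma rD_fork_braid:
  assumes "1 \<le> b" "e \<in> {1, - 1}"
  shows "rD (fork e b) \<circ> rD (fork e (b + 1)) \<circ> rD (fork e b) =
         rD (fork e (b + 1)) \<circ> rD (fork e b) \<circ> rD (fork e (b + 1))"
proof (cases "fork e b = - 1")
  case True
  then have "b = 1" "e = - 1" using assms by (auto simp: fork_def split: if_splits)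
  then show ?thesis using rD_m1_braid by (simp add: fork_def)
next
  case False
  then have "fork e b = b" "fork e (b + 1) = b + 1" using assms by (auto simp: fork_def)
  then show ?thesis using rD_braid[OF assms(1)] by simp
qed

text \<open>The two tips of the fork are not joined in the Dynkin diagram.\<close>

lemma rD_1_m1_commute: "rD 1 \<circ> rD (- 1) = rD (- 1) \<circ> rD 1"
proof
  fix x :: int
  have b: "rD 1 1 = 2" "rD 1 2 = 1" "rD 1 (- 1) = - 2" "rD 1 (- 2) = - 1"
    and c: "rD (- 1) 1 = - 2" "rD (- 1) 2 = - 1" "rD (- 1) (- 1) = 2" "rD (- 1) (- 2) = 1"
    by (simp_all add: rD_pos rD_m1)
  consider "x \<in> {1, 2, - 1, - 2}" | "rD 1 x = x" "rD (- 1) x = x"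
  proof (cases "x \<in> {1, 2, - 1, - 2}")
    case False
    have "rD 1 x = x" "rD (- 1) x = x"
      by (rule rD_outside; use False in simp; linarith)+
    then show ?thesis by (rule that(2))
  qed (rule that(1))
  then show "(rD 1 \<circ> rD (- 1)) x = (rD (- 1) \<circ> rD 1) x"
    unfolding comp_def by cases (auto simp only: b c insert_iff empty_iff)
qed

section \<open>Ascending products passing through the staircase\<close>

lemma down_rec: "k \<le> int n - 1 \<Longrightarrow> down n e k x = down n e (k + 1) x @ [(fork e k, x)]"
  by (simp add: down_def upto_rec1)

lemma up_rec: "k \<le> int n - 1 \<Longrightarrow> up n e k x = (fork e k, x) # up n e (k + 1) x"
  by (simp add: up_def upto_rec1)

lemma down_Nil [simp]: "k \<ge> int n \<Longrightarrow> down n e k x = []"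
  by (simp add: down_def)

lemma up_Nil [simp]: "k \<ge> int n \<Longrightarrow> up n e k x = []"
  by (simp add: up_def)

lemma down_commute:
  assumes "1 \<le> b" "b + 2 \<le> k" "e \<in> {1, - 1}"
  shows "nil_eqv n ((fork e b, x) # down n e' k y) (down n e' k y @ [(fork e b, x)])"
  by (rule nil_eqv_commute_list)
    (use rD_fork_commute[OF assms(1) _ assms(3)] assms(2) in \<open>auto simp: down_def\<close>)

lemma up_commute:
  assumes "1 \<le> b" "b + 2 \<le> k" "e \<in> {1, - 1}"
  shows "nil_eqv n ((fork e b, x) # up n e' k y) (up n e' k y @ [(fork e b, x)])"
  by (rule nil_eqv_commute_list)
    (use rD_fork_commute[OF assms(1) _ assms(3)] assms(2) in \<open>auto simp: up_def\<close>)

text \<open>Downward induction on \<open>k\<close>, starting from the merger of two equal letters at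
  \<open>n - 1\<close>. A new smallest letter commutes with all letters but its neighbour, so its
  two copies meet around the middle factor, where Yang-Baxter applies.\<close>

lemma up_down:
  assumes "k \<le> int n - 1" "1 \<le> k" "e \<in> {1, - 1}"
  shows "nil_eqv n (up n e k y @ down n e k x)
           (down n e (k + 1) x @ [(fork e k, x + y)] @ up n e (k + 1) y)"
  using assms(1,2)
proof (induction k rule: int_le_induct)
  case base
  then show ?case using nil_eqv_add[of n "fork e (int n - 1)" y x]
    by (simp add: down_rec up_rec add.commute)
next
  case (step k)
  \<comment> \<open>The induction step concerns \<open>k - 1\<close>; \<open>j\<close> names this
    new smallest letter.\<close>
  define j where "j = k - 1"
  have j: "k = j + 1" "1 \<le> j" "j + 1 \<le> int n - 1" using step by (auto simp: j_def)
  then have k: "k \<le> int n - 1" by simp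
  have "up n e j y @ down n e j x = [(fork e j, y)] @ (up n e k y @ down n e k x) @ [(fork e j, x)]"
    using j by (simp add: down_rec up_rec)
  also have "nil_eqv n \<dots> ([(fork e j, y)] @ (down n e (k + 1) x @ [(fork e k, x + y)] @ up n e (k + 1) y)
      @ [(fork e j, x)])"
    using step j by (intro nil_eqv_congs) auto
  also have "\<dots> = ((fork e j, y) # down n e (k + 1) x) @ [(fork e k, x + y)] @ (up n e (k + 1) y
      @ [(fork e j, x)])" by simp
  \<comment> \<open>The letters from \<open>k + 1 = j + 2\<close> on commute with \<open>j\<close>,
    which brings both copies of \<open>j\<close> next to the factor with letter
    \<open>k\<close>.\<close>
  also have "nil_eqv n \<dots> ((down n e (k + 1) x @ [(fork e j, y)]) @ [(fork e k, x + y)] @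
      ((fork e j, x) # up n e (k + 1) y))"
    using j assms(3) by (intro nil_eqv_append nil_eqv_refl down_commute nil_eqv_sym[OF up_commute]) auto
  also have "\<dots> = down n e (k + 1) x @ [(fork e j, y), (fork e k, y + x), (fork e j, x)] @ up n e (k + 1) y"
    by (simp add: add.commute)
  also have "nil_eqv n \<dots>
      (down n e (k + 1) x @ [(fork e k, x), (fork e j, y + x), (fork e k, y)] @ up n e (k + 1) y)"
    unfolding j(1) using j assms(3) by (intro nil_eqv_congs nil_eqv_Yang_Baxter rD_fork_braid)
  also have "down n e (k + 1) x @ [(fork e k, x), (fork e j, y + x), (fork e k, y)] @ up n e (k + 1) y =
      down n e k x @ [(fork e j, x + y)] @ up n e k y"
  proof -
    have "down n e k x = down n e (k + 1) x @ [(fork e k, x)]"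
      using k by (rule down_rec)
    moreover have "up n e k y = (fork e k, y) # up n e (k + 1) y"
      using k by (rule up_rec)
    moreover have "y + x = x + y" by (rule add.commute)
    ultimately show ?thesis by (simp only: append_assoc append_Cons append_Nil)
  qed
  finally show ?case unfolding j_def by simp
qed

definition stairs :: "nat \<Rightarrow> int \<Rightarrow> int \<Rightarrow> (int \<Rightarrow> 'a) \<Rightarrow> (int \<times> 'a) list" where
  "stairs n e k X = concat (map (\<lambda>b. down n e b (X b)) [k..int n - 1])"

text \<open>Each block has lost its smallest letter but kept its variable, as in
  \<open>A_2(x_1) ... A_{n-1}(x_{n-2})\<close>; the block of index \<open>n - 1\<close> is
  empty.\<close>

definition shifted_stairs :: "nat \<Rightarrow> int \<Rightarrow> int \<Rightarrow> (int \<Rightarrow> 'a) \<Rightarrow> (int \<times> 'a) list" where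
  "shifted_stairs n e k X = concat (map (\<lambda>b. down n e (b + 1) (X b)) [k..int n - 1])"

lemma shifted_stairs_commute:
  assumes "1 \<le> b" "b < k" "e \<in> {1, - 1}"
  shows "nil_eqv n ((fork e b, x) # shifted_stairs n e' k X) (shifted_stairs n e' k X @ [(fork e b, x)])"
  by (rule nil_eqv_commute_list)
    (use rD_fork_commute[OF assms(1) _ assms(3)] assms(2) in \<open>auto simp: shifted_stairs_def down_def\<close>)

text \<open>Downward induction from the empty case \<open>k = n\<close>: \<open>up_down\<close>
  carries the ascending product through the first block, and the factor it leaves behind commutes
  with the remaining shifted blocks, whose letters are larger by at least 2.\<close>

lemma up_stairs:
  assumes "k \<le> int n" "1 \<le> k" "e \<in> {1, - 1}"
  shows "nil_eqv n (up n e k y @ stairs n e k X)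
           (shifted_stairs n e k X @ map (\<lambda>b. (fork e b, X b + y)) [k..int n - 1])"
  using assms(1,2)
proof (induction k rule: int_le_induct)
  case base
  then show ?case by (simp add: stairs_def shifted_stairs_def)
next
  case (step k)
  define j where "j = k - 1"
  have j: "k = j + 1" "1 \<le> j" "j \<le> int n - 1" using step by (auto simp: j_def)
  then have upto: "[j..int n - 1] = j # [k..int n - 1]" by (simp add: upto_rec1)
  let ?h = "(fork e j, X j + y)"
  have "up n e j y @ stairs n e j X = (up n e j y @ down n e j (X j)) @ stairs n e k X"
    unfolding stairs_def upto by simp
  also have "nil_eqv n \<dots> ((down n e k (X j) @ [?h] @ up n e k y) @ stairs n e k X)"
    unfolding j(1) using j assms(3) by (intro nil_eqv_append nil_eqv_refl up_down)
  also have "\<dots> = (down n e k (X j) @ [?h]) @ (up n e k y @ stairs n e k X)"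
    by simp
  also have "nil_eqv n \<dots> ((down n e k (X j) @ [?h]) @
      (shifted_stairs n e k X @ map (\<lambda>b. (fork e b, X b + y)) [k..int n - 1]))"
    using step j by (intro nil_eqv_append[OF nil_eqv_refl]) auto
  also have "\<dots> = down n e k (X j) @ (?h # shifted_stairs n e k X) @ 
      map (\<lambda>b. (fork e b, X b + y)) [k..int n - 1]" by simp
  also have "nil_eqv n \<dots> (down n e k (X j) @ (shifted_stairs n e k X @ [?h]) @ 
      map (\<lambda>b. (fork e b, X b + y)) [k..int n - 1])"
    using j assms(3) by (intro nil_eqv_congs shifted_stairs_commute) auto
  also have "\<dots> = shifted_stairs n e j X @ map (\<lambda>b. (fork e b, X b + y)) [j..int n - 1]"
    unfolding shifted_stairs_def upto by (simp add: j(1))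
  finally show ?case unfolding j_def by simp
qed

section \<open>Blocks of nonpositive index and the recursion for the product\<close>

definition full_block :: "nat \<Rightarrow> 'a \<Rightarrow> (int \<times> 'a) list" where
  "full_block n x = map (\<lambda>b. (b, x)) (rev [1..int n - 1] @ rev [1 - int n..- 1])"

lemma rev_upto: "rev [a..b] = map uminus [- b..- a]"
  by (rule nth_equalityI) (auto simp: rev_nth nth_upto)

lemma map_upto_shift: "map f [a + c..b + c] = map (\<lambda>i. f (i + c)) [a..b]" for c :: int
  by (rule nth_equalityI) (auto simp: nth_upto algebra_simps)

lemma nil_eqv_fork_m1:
  "nil_eqv n (map (\<lambda>b. (- b, f b)) [1..int n - 1]) (map (\<lambda>b. (fork (- 1) b, f b)) [1..int n - 1])"
  by (rule nil_eqv_map) (auto simp: fork_def intro: nil_eqv_uminus)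

text \<open>\<open>full_block n x\<close> is \<open>C(x)\<close>. Its letters of absolute value at
  least 2 may change sign, and the two middle factors, with letters 1 and \<open>- 1\<close>,
  commute; so either sign can close the descending half.\<close>

lemma full_block_eqv:
  assumes "e \<in> {1, - 1}"
  shows "nil_eqv n (full_block n x) (down n (- e) 1 x @ up n e 1 x)"
proof -
  have "full_block n x = down n 1 1 x @ map (\<lambda>b. (- b, x)) [1..int n - 1]"
    by (simp add: full_block_def rev_upto[of "1 - int n"] down_def fork_def cong: if_cong)
  also have "nil_eqv n \<dots> (down n 1 1 x @ up n (- 1) 1 x)"
    unfolding up_def by (intro nil_eqv_append[OF nil_eqv_refl] nil_eqv_fork_m1)
  finally have *: "nil_eqv n (full_block n x) (down n 1 1 x @ up n (- 1) 1 x)" .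
  show ?thesis
  proof (cases "e = - 1")
    case True
    then show ?thesis using * by simp
  next
    case False
    then have e: "e = 1" using assms by simp
    show ?thesis
    proof (cases "1 \<le> int n - 1")
      case True
      have ind: "down n e 2 x = down n e' 2 x" "up n e 2 x = up n e' 2 x" for e e'
        by (auto simp: down_def up_def fork_def)
      have "down n 1 1 x @ up n (- 1) 1 x = down n 1 2 x @ [(1, x), (- 1, x)] @ up n 1 2 x"
        using True by (simp add: down_rec[of 1] up_rec[of 1] ind[of "- 1" 1]) (simp add: fork_def)
      also have "nil_eqv n \<dots> (down n 1 2 x @ [(- 1, x), (1, x)] @ up n 1 2 x)"
        by (intro nil_eqv_congs nil_eqv_commute rD_1_m1_commute)
      also have "\<dots> = down n (- 1) 1 x @ up n 1 1 x"
        using True by (simp add: down_rec[of 1] up_rec[of 1] ind[of "- 1" 1]) (simp add: fork_def)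
      finally show ?thesis using nil_eqv_trans[OF *] e by simp
    next
      case False
      then show ?thesis by (simp add: full_block_def)
    qed
  qed
qed

text \<open>The infinite product is cut off on the left at index \<open>1 - M\<close>. The sign
  \<open>e\<close> is carried along because each step of the recursion exchanges 1 and
  \<open>- 1\<close>.\<close>

definition schubert_factors :: "nat \<Rightarrow> int \<Rightarrow> nat \<Rightarrow> (int \<Rightarrow> 'a) \<Rightarrow> (int \<times> 'a) list" where
  "schubert_factors n e M X =
     concat (map (\<lambda>i. full_block n (X i)) [1 - int M..0]) @ stairs n e 1 X"

text \<open>The descending half of \<open>C(x_0)\<close> serves as the missing first block of a
  staircase with lowered indices. Only this block contains a letter of absolute value 1, so the
  whole staircase takes the sign \<open>- e\<close>.\<close>

lemma down_shifted_stairs: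
  "down n (- e) 1 (X 0) @ shifted_stairs n e 1 X = stairs n (- e) 1 (\<lambda>i. X (i - 1))"
proof (cases "1 \<le> int n - 1")
  case True
  have "shifted_stairs n e 1 X = concat (map (\<lambda>b. down n e b (X (b - 1))) [2..int n])"
    using map_upto_shift[of "\<lambda>b. down n e b (X (b - 1))" 1 1 "int n - 1"]
    by (simp add: shifted_stairs_def)
  \<comment> \<open>The block for \<open>b = n\<close> is empty.\<close>
  also have "\<dots> = concat (map (\<lambda>b. down n e b (X (b - 1))) [2..int n - 1])"
    using True by (simp add: upto_rec2)
  also have "\<dots> = concat (map (\<lambda>b. down n (- e) b (X (b - 1))) [2..int n - 1])"
    by (intro arg_cong[where f = concat] map_cong refl) (auto simp: down_def fork_def)
  finally show ?thesis using True by (simp add: stairs_def upto_rec1)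
next
  case False
  then show ?thesis by (simp add: shifted_stairs_def stairs_def)
qed

text \<open>One step: \<open>C(x_0)\<close> is split, its ascending half moves through the staircase
  by \<open>up_stairs\<close>, and its descending half completes the shifted staircase.\<close>

lemma schubert_factors_Suc:
  assumes "e \<in> {1, - 1}" "n > 0"
  shows "nil_eqv n (schubert_factors n e (Suc M) X)
    (schubert_factors n (- e) M (\<lambda>i. X (i - 1)) @ map (\<lambda>b. (fork e b, X b + X 0)) [1..int n - 1])"
proof -
  let ?H = "concat (map (\<lambda>i. full_block n (X (i - 1))) [1 - int M..0])"
  let ?R = "map (\<lambda>b. (fork e b, X b + X 0)) [1..int n - 1]"
  have "[- int M..0] = [- int M..- 1] @ [0]" by (simp add: upto_rec2)
  moreover have "map (\<lambda>i. full_block n (X (i - 1))) [1 - int M..0] = map (\<lambda>i. full_block n (X i)) [- int M..- 1]"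
    using map_upto_shift[of "\<lambda>i. full_block n (X (i - 1))" "- int M" 1 "- 1"] by simp
  ultimately have "schubert_factors n e (Suc M) X = ?H @ full_block n (X 0) @ stairs n e 1 X"
    by (simp add: schubert_factors_def)
  also have "nil_eqv n \<dots> (?H @ (down n (- e) 1 (X 0) @ up n e 1 (X 0)) @ stairs n e 1 X)"
    by (intro nil_eqv_congs full_block_eqv assms)
  also have "\<dots> = (?H @ down n (- e) 1 (X 0)) @ (up n e 1 (X 0) @ stairs n e 1 X)" by simp
  also have "nil_eqv n \<dots> ((?H @ down n (- e) 1 (X 0)) @ (shifted_stairs n e 1 X @ ?R))"
    using assms by (intro nil_eqv_append nil_eqv_refl up_stairs) auto
  also have "\<dots> = ?H @ (down n (- e) 1 (X 0) @ shifted_stairs n e 1 X) @ ?R"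
    by simp
  also have "\<dots> = schubert_factors n (- e) M (\<lambda>i. X (i - 1)) @ ?R"
    unfolding down_shifted_stairs by (simp add: schubert_factors_def)
  finally show ?thesis .
qed

text \<open>The letters appear as -1, -2, ..., 1, 2, ..., which is the order \<open>precD\<close>.
  This is how that order enters \<open>comajD\<close>.\<close>

definition step_factors :: "nat \<Rightarrow> (int \<Rightarrow> 'a::plus) \<Rightarrow> (int \<times> 'a) list" where
  "step_factors n X = map (\<lambda>b. (- b, X (b - 1) + X (- 1))) [1..int n - 1] @
                      map (\<lambda>b. (b, X b + X 0)) [1..int n - 1]"

text \<open>Two steps restore the sign 1. The second acts on variables already lowered by one, hence
  \<open>X (b - 1) + X (- 1)\<close>, and its letters are renamed to negative ones so that every
  signed letter occurs exactly once.\<close>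

lemma schubert_factors_Suc_Suc:
  assumes "n > 0"
  shows "nil_eqv n (schubert_factors n 1 (Suc (Suc M)) X)
    (schubert_factors n 1 M (\<lambda>i. X (i - 2)) @ step_factors n X)"
proof -
  let ?R = "map (\<lambda>b. (fork 1 b, X b + X 0)) [1..int n - 1]"
  let ?R' = "map (\<lambda>b. (fork (- 1) b, X (b - 1) + X (- 1))) [1..int n - 1]"
  have "nil_eqv n (schubert_factors n 1 (Suc (Suc M)) X)
      (schubert_factors n (- 1) (Suc M) (\<lambda>i. X (i - 1)) @ ?R)"
    by (intro schubert_factors_Suc assms) auto
  also have "nil_eqv n \<dots> ((schubert_factors n 1 M (\<lambda>i. X (i - 2)) @ ?R') @ ?R)"
    using schubert_factors_Suc[of "- 1" n M "\<lambda>i. X (i - 1)"] assms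
    by (intro nil_eqv_append nil_eqv_refl) auto
  also have "\<dots> = (schubert_factors n 1 M (\<lambda>i. X (i - 2))) @ ?R' @ ?R"
    by simp
  also have "nil_eqv n \<dots> ((schubert_factors n 1 M (\<lambda>i. X (i - 2))) @
     map (\<lambda>b. (- b, X (b - 1) + X (- 1))) [1..int n - 1] @ ?R)"
    by (intro nil_eqv_congs nil_eqv_sym[OF nil_eqv_fork_m1])
  also have "?R = map (\<lambda>b. (b, X b + X 0)) [1..int n - 1]"
    by (auto simp: fork_def)
  finally show ?thesis by (simp add: step_factors_def)
qed

section \<open>Expansion over compatible sequences\<close>

definition unit_word :: "int list \<Rightarrow> 'a::comm_ring_1" where
  "unit_word a = (if a = [] then 1 else 0)"

text \<open>The order in which the factors occur in the product: a word together with a compatible sequence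
  is a strictly increasing sequence of pairs (index, letter).\<close>

definition index_letter_less :: "int \<times> int \<Rightarrow> int \<times> int \<Rightarrow> bool" where
  "index_letter_less p r \<longleftrightarrow> fst p < fst r \<or> fst p = fst r \<and> snd p > snd r"

definition index_seqs :: "(int \<times> int) set \<Rightarrow> int list \<Rightarrow> int list set" where
  "index_seqs Q a = {s. length s = length a \<and> sorted_wrt index_letter_less (zip s a) \<and> set (zip s a) \<subseteq> Q}"

lemma index_seqs_Nil [simp]: "index_seqs Q [] = {[]}"
  by (auto simp: index_seqs_def)

lemma finite_index_seqs:
  assumes "finite Q"
  shows "finite (index_seqs Q a)"
proof (rule finite_subset)
  show "index_seqs Q a \<subseteq> {s. set s \<subseteq> fst ` Q \<and> length s = length a}"
  proof
    fix s assume s: "s \<in> index_seqs Q a"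
    then have "set s = fst ` set (zip s a)"
      by (metis (mono_tags, lifting) index_seqs_def list.set_map map_fst_zip mem_Collect_eq)
    then show "s \<in> {s. set s \<subseteq> fst ` Q \<and> length s = length a}"
      using s by (auto simp: index_seqs_def)
  qed
  show "finite {s. set s \<subseteq> fst ` Q \<and> length s = length a}"
    using assms by (simp add: finite_lists_length_eq)
qed

lemma index_seqs_snoc:
  assumes "\<And>r. r \<in> Q \<Longrightarrow> index_letter_less r (i, b)"
  shows "index_seqs (insert (i, b) Q) (a @ [c]) =
    index_seqs Q (a @ [c]) \<union> (if c = b then (\<lambda>s. s @ [i]) ` index_seqs Q a else {})" (is "?L = ?R")
proof (intro equalityI subsetI)
  fix t assume t: "t \<in> ?L"
  then have "t \<noteq> []" by (auto simp: index_seqs_def)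
  then obtain s k where sk: "t = s @ [k]" by (metis rev_exhaust)
  have len: "length s = length a" using t by (simp add: index_seqs_def sk)
  have *: "sorted_wrt index_letter_less (zip s a)" "\<And>r. r \<in> set (zip s a) \<Longrightarrow> index_letter_less r (k, c)"
    "set (zip s a) \<subseteq> insert (i, b) Q" "(k, c) \<in> insert (i, b) Q"
    using t len by (auto simp: index_seqs_def sk sorted_wrt_append)
  have "(i, b) \<notin> set (zip s a)"
  proof
    assume "(i, b) \<in> set (zip s a)"
    then have "index_letter_less (i, b) (k, c)" using * by blast
    then show False using *(4) assms[of "(k, c)"] by (auto simp: index_letter_less_def)
  qed
  then have "set (zip s a) \<subseteq> Q" using * by blast
  then show "t \<in> ?R"
    using * len by (auto simp: index_seqs_def sk sorted_wrt_append)
next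
  fix t assume "t \<in> ?R"
  then show "t \<in> ?L"
    by (auto simp: index_seqs_def sorted_wrt_append split: if_splits) (use assms in blast)
qed

text \<open>Expanding the product means choosing a subsequence of the factors; its letters spell the
  word and its indices form the sequence.\<close>

lemma mult_factors_unit_word:
  assumes "sorted_wrt index_letter_less Q"
  shows "mult_factors unit_word (map (\<lambda>(i, b). (b, X i)) Q) a =
           (\<Sum>s\<in>index_seqs (set Q) a. prod_list (map X s))"
  using assms
proof (induction Q arbitrary: a rule: rev_induct)
  case Nil
  have "index_seqs {} a = {}" if "a \<noteq> []"
    using that by (cases a) (auto simp: index_seqs_def Suc_length_conv length_Suc_conv)
  then show ?case by (cases "a = []") (auto simp: unit_word_def)
next
  case (snoc h Q)
  obtain i b where h: "h = (i, b)" by (cases h)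
  let ?f = "mult_factors unit_word (map (\<lambda>(i, b). (b, X i)) Q)"
  have IH: "?f a = (\<Sum>s\<in>index_seqs (set Q) a. prod_list (map X s))" for a
    using snoc by (simp add: sorted_wrt_append)
  have less: "index_letter_less r (i, b)" if "r \<in> set Q" for r
    using snoc.prems that by (simp add: sorted_wrt_append h)
  have step: "mult_factors unit_word (map (\<lambda>(i, b). (b, X i)) (Q @ [h])) a =
      ?f a + X i * suffix_part [b] ?f a"
    by (simp add: h mult_factor_def)
  show ?case
  proof (cases a rule: rev_exhaust)
    case Nil
    then have "suffix_part [b] ?f a = 0" by (intro suffix_part_zero) auto
    then show ?thesis unfolding step IH using Nil by simp
  next
    case (snoc d c)
    have set: "set (Q @ [h]) = insert (i, b) (set Q)" by (simp add: h)
    have seqs: "index_seqs (insert (i, b) (set Q)) (d @ [c]) = index_seqs (set Q) (d @ [c]) \<union>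
        (if c = b then (\<lambda>s. s @ [i]) ` index_seqs (set Q) d else {})"
      by (rule index_seqs_snoc) (rule less)
    show ?thesis
    proof (cases "c = b")
      case True
      have "index_seqs (set Q) a \<inter> (\<lambda>s. s @ [i]) ` index_seqs (set Q) d = {}"
      proof -
        have "(i, b) \<notin> set Q" using less by (force simp: index_letter_less_def)
        then show ?thesis by (auto simp: index_seqs_def snoc True)
      qed
      moreover have "suffix_part [b] ?f a = ?f d" by (simp add: snoc True)
      ultimately show ?thesis
        unfolding step set unfolding snoc seqs unfolding True if_True
        by (subst sum.union_disjoint)
          (auto simp: finite_index_seqs IH sum.reindex inj_on_def sum_distrib_left mult.commute)
    next
      case False
      then have "suffix_part [b] ?f a = 0" by (intro suffix_part_zero) (auto simp: snoc)
      then show ?thesis unfolding step set unfolding snoc seqs using False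
        by (simp add: IH)
    qed
  qed
qed

definition block_letters :: "nat \<Rightarrow> int \<Rightarrow> int list" where
  "block_letters n i = (if i \<le> 0 then rev [1..int n - 1] @ rev [1 - int n..- 1] else rev [i..int n - 1])"

text \<open>The list follows the order of the factors; it may stop at \<open>n - 1\<close> because
  later blocks are empty.\<close>

definition index_letters :: "nat \<Rightarrow> nat \<Rightarrow> (int \<times> int) list" where
  "index_letters n M = concat (map (\<lambda>i. map (Pair i) (block_letters n i)) [1 - int M..int n - 1])"

lemma schubert_factors_conv:
  assumes "n > 0"
  shows "schubert_factors n 1 M X = map (\<lambda>(i, b). (b, X i)) (index_letters n M)"
proof -
  have split: "[1 - int M..int n - 1] = [1 - int M..0] @ [1..int n - 1]"
    using assms upto_split2[of "1 - int M" 0 "int n - 1"] by (cases "M = 0") auto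
  have 1: "full_block n (X i) = map (\<lambda>(i, b). (b, X i)) (map (Pair i) (block_letters n i))" if "i \<le> 0" for i
    using that by (simp add: full_block_def block_letters_def)
  have 2: "down n 1 i (X i) = map (\<lambda>(i, b). (b, X i)) (map (Pair i) (block_letters n i))" if "i > 0" for i
    using that by (simp add: down_def block_letters_def fork_def cong: if_cong)
  show ?thesis
    unfolding schubert_factors_def stairs_def index_letters_def split map_append concat_append map_concat map_map
    by (intro arg_cong2[where f = append] arg_cong[where f = concat] map_cong refl) (use 1 2 in auto)
qed

lemma sorted_wrt_greater_rev_upto: "sorted_wrt (>) (rev [a..b])"
  using sorted_wrt_upto[of a b] by (simp add: sorted_wrt_rev)

lemma sorted_index_letters: "sorted_wrt index_letter_less (index_letters n M)"
proof -
  have *: "sorted_wrt (>) (block_letters n i)" for i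
    using sorted_wrt_greater_rev_upto by (auto simp: block_letters_def sorted_wrt_append)
  have "sorted_wrt index_letter_less (concat (map (\<lambda>i. map (Pair i) (block_letters n i)) is))"
    if "sorted_wrt (<) is" for "is"
    using that
    by (induction "is") (auto simp: sorted_wrt_append sorted_wrt_map index_letter_less_def * )
  then show ?thesis unfolding index_letters_def using sorted_wrt_upto by blast
qed

lemma set_index_letters:
  assumes "n > 0"
  shows "set (index_letters n M) = {(i, b). 1 - int M \<le> i \<and> b \<in> lettersD n \<and> (i > 0 \<longrightarrow> i \<le> b)}"
proof -
  have "set (block_letters n i) = {b \<in> lettersD n. i > 0 \<longrightarrow> i \<le> b}" for i
    by (auto simp: block_letters_def lettersD_def)
  moreover have "(i, b) \<in> set (index_letters n M) \<longleftrightarrow>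
      i \<in> {1 - int M..int n - 1} \<and> b \<in> set (block_letters n i)" for i b
    by (auto simp: index_letters_def)
  ultimately show ?thesis using assms by (auto simp: lettersD_def)
qed

text \<open>By transitivity only adjacent pairs matter. Equal adjacent indices require a strict
  descent of the letters, which is the compatibility condition, and membership of the pairs encodes
  the two bounds on the indices.\<close>

lemma index_seqs_index_letters:
  assumes "n > 0" "a \<in> lists (lettersD n)"
  shows "index_seqs (set (index_letters n M)) a = {s \<in> compatible a. \<forall>i\<in>set s. 1 - int M \<le> i}"
proof -
  have trans: "transp index_letter_less"
    by (auto simp: transp_def index_letter_less_def)
  have "s \<in> index_seqs (set (index_letters n M)) a \<longleftrightarrow> s \<in> {s \<in> compatible a. \<forall>i\<in>set s. 1 - int M \<le> i}"
    (is "?P \<longleftrightarrow> ?Q") for s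
  proof (cases "length s = length a")
    case True
    have "sorted_wrt index_letter_less (zip s a) \<longleftrightarrow>
        (\<forall>j. Suc j < length a \<longrightarrow> s ! j < s ! Suc j \<or> s ! j = s ! Suc j \<and> a ! j > a ! Suc j)"
      using True by (auto simp: sorted_wrt_iff_nth_Suc_transp[OF trans] index_letter_less_def)
    also have "\<dots> \<longleftrightarrow> sorted s \<and> (\<forall>j. Suc j < length a \<longrightarrow> a ! j \<le> a ! Suc j \<longrightarrow> s ! j < s ! Suc j)"
      using True by (auto simp: sorted_iff_nth_Suc)
    finally have 1: "sorted_wrt index_letter_less (zip s a) \<longleftrightarrow> \<dots>" .
    have "set (zip s a) \<subseteq> set (index_letters n M) \<longleftrightarrow>
      (\<forall>j<length a. 1 - int M \<le> s ! j) \<and> (\<forall>j<length a. 0 < s ! j \<longrightarrow> s ! j \<le> a ! j)"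
      using True assms by (auto simp: set_index_letters set_zip in_lists_conv_set)
    also have "(\<forall>j<length a. 1 - int M \<le> s ! j) \<longleftrightarrow> (\<forall>i\<in>set s. 1 - int M \<le> i)"
      using True by (auto simp: all_set_conv_all_nth)
    finally show ?thesis using True 1 by (auto simp: index_seqs_def compatible_def)
  qed (auto simp: index_seqs_def compatible_def)
  then show ?thesis by blast
qed

lemma finite_bounded_compatible:
  assumes "n > 0" "a \<in> lists (lettersD n)"
  shows "finite {s \<in> compatible a. \<forall>i\<in>set s. 1 - int M \<le> i}"
  using finite_index_seqs[of "set (index_letters n M)" a] index_seqs_index_letters[OF assms] by simp

lemma mult_schubert_factors:
  assumes "n > 0" "a \<in> lists (lettersD n)"
  shows "mult_factors unit_word (schubert_factors n 1 M X) a =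
    (\<Sum>s | s \<in> compatible a \<and> (\<forall>i\<in>set s. 1 - int M \<le> i). prod_list (map X s))"
  by (simp add: schubert_factors_conv[OF assms(1)] mult_factors_unit_word sorted_index_letters
      index_seqs_index_letters[OF assms])

section \<open>The recursion for the right-hand side\<close>

context
  fixes q :: "'a::field"
  assumes q_nonzero: "q \<noteq> 0" and q_pow: "\<And>m. m > 0 \<Longrightarrow> q ^ m \<noteq> 1"
begin

definition word_weight :: "int list \<Rightarrow> 'a" where
  "word_weight a = (\<Prod>b\<leftarrow>a. q ^ nat \<bar>b\<bar> + 1) / (\<Prod>j=1..length a. q ^ (2 * j) - 1) * q ^ comajD a"

text \<open>Dividing every variable by \<open>q^(2j)\<close> multiplies the coefficient of a word of
  length p by \<open>q^(-2jp)\<close>; this is the expected coefficient for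
  \<open>x_i = q^(i-1-2j)\<close>.\<close>

definition scaled_weight :: "int \<Rightarrow> int list \<Rightarrow> 'a" where
  "scaled_weight j a = q powi (- 2 * j * int (length a)) * word_weight a"

text \<open>The parameter of the letter \<open>c\<close> in \<open>step_factors\<close> at
  \<open>x_i = q^(i-1-2j)\<close>. It supplies the numerator \<open>q^|c| + 1\<close>, and the extra
  \<open>q\<close> accounts for the count of positive letters in \<open>comajD\<close>.\<close>

definition letter_coeff :: "int \<Rightarrow> int \<Rightarrow> 'a" where
  "letter_coeff j c = q powi (- 2 * j - 2) * (q ^ nat \<bar>c\<bar> + 1) * (if c > 0 then q else 1)"

lemma powi_add: "q powi (x + y) = q powi x * q powi y"
  using q_nonzero by (simp add: power_int_add)

lemma comajD_snoc:
  "comajD (a @ [c]) = comajD a + (if c > 0 then 1 else 0) +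
     (if a \<noteq> [] \<and> precD (last a) c then 2 * length a else 0)"
proof -
  have "{j. j < length (a @ [c]) \<and> 0 < (a @ [c]) ! j} =
      {j. j < length a \<and> 0 < a ! j} \<union> (if c > 0 then {length a} else {})"
    by (auto simp: nth_append less_Suc_eq)
  then have 1: "card {j. j < length (a @ [c]) \<and> 0 < (a @ [c]) ! j} =
      card {j. j < length a \<and> 0 < a ! j} + (if c > 0 then 1 else 0)"
    by (simp only:) (subst card_Un_disjoint, auto)
  let ?A = "{j. Suc j < length a \<and> precD (a ! j) (a ! Suc j)}"
  let ?B = "{j. Suc j < length (a @ [c]) \<and> precD ((a @ [c]) ! j) ((a @ [c]) ! Suc j)}"
  \<comment> \<open>The only possible new ascent joins the last letter of \<open>a\<close> to
    \<open>c\<close>. Its position is \<open>length a - 1\<close>, counted from 0, so it weighs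
    \<open>2 * length a\<close>.\<close>
  have AB: "?B = ?A \<union> (if a \<noteq> [] \<and> precD (last a) c then {length a - 1} else {})"
    by (cases a rule: rev_cases) (auto simp: nth_append less_Suc_eq)
  have fin: "finite ?A"
    by (rule finite_subset[of _ "{..<length a}"]) auto
  have 2: "(\<Sum>j\<in>?B. 2 * (j + 1)) = (\<Sum>j\<in>?A. 2 * (j + 1)) +
     (if a \<noteq> [] \<and> precD (last a) c then 2 * length a else 0)"
  proof (cases "a \<noteq> [] \<and> precD (last a) c")
    case True
    have "(\<Sum>j\<in>?A \<union> {length a - 1}. 2 * (j + 1)) = (\<Sum>j\<in>?A. 2 * (j + 1)) + (\<Sum>j\<in>{length a - 1}. 2 * (j + 1))"
      by (rule sum.union_disjoint[OF fin]) auto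
    moreover have "length a > 0" using True by simp
    ultimately show ?thesis unfolding AB if_P[OF True] by (simp only: sum.insert finite.emptyI sum.empty) simp
  next
    case False
    show ?thesis unfolding AB if_not_P[OF False] by (simp only: Un_empty_right add_0_right)
  qed
  show ?thesis unfolding comajD_def 1 2 by simp
qed

lemma word_weight_snoc:
  "word_weight (a @ [c]) * (q ^ (2 * Suc (length a)) - 1) = word_weight a * (q ^ nat \<bar>c\<bar> + 1) *
     (if c > 0 then q else 1) * (if a \<noteq> [] \<and> precD (last a) c then q ^ (2 * length a) else 1)"
proof -
  have "q ^ (2 * Suc (length a)) - 1 \<noteq> 0" using q_pow[of "2 * Suc (length a)"] by simp
  moreover have "(\<Prod>j=1..length (a @ [c]). q ^ (2 * j) - 1) =
      (\<Prod>j=1..length a. q ^ (2 * j) - 1) * (q ^ (2 * Suc (length a)) - 1)"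
    by simp
  moreover have "q ^ comajD (a @ [c]) = q ^ comajD a * (if c > 0 then q else 1) *
      (if a \<noteq> [] \<and> precD (last a) c then q ^ (2 * length a) else 1)"
    by (simp add: comajD_snoc power_add)
  ultimately show ?thesis unfolding word_weight_def by simp
qed

text \<open>Passing from level \<open>j + 1\<close> to level \<open>j\<close> multiplies the weight
  of a word of length L + 1 by \<open>q^(2L+2)\<close>, so the difference cancels the last
  denominator. An ascent before \<open>c\<close> contributes \<open>q^(2L)\<close>, exactly what
  lifts \<open>a\<close> from level \<open>j + 1\<close> to \<open>j\<close>.\<close>

lemma scaled_weight_snoc:
  "scaled_weight j (a @ [c]) = scaled_weight (j + 1) (a @ [c]) +
     letter_coeff j c * (if a \<noteq> [] \<and> precD (last a) c then scaled_weight j a else scaled_weight (j + 1) a)"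
proof -
  define L where "L = int (length a)"
  define e where "e = (if c > 0 then q else 1) * (q ^ nat \<bar>c\<bar> + 1)"
  have pw: "q ^ (2 * Suc (length a)) = q powi (2 * L + 2)" "q ^ (2 * length a) = q powi (2 * L)"
    unfolding L_def by (simp_all flip: power_int_of_nat add: algebra_simps)
  have W: "word_weight (a @ [c]) * (q powi (2 * L + 2) - 1) =
      word_weight a * e * (if a \<noteq> [] \<and> precD (last a) c then q powi (2 * L) else 1)"
    using word_weight_snoc[of a c] unfolding pw e_def by (simp only: mult_ac)
  have "scaled_weight j (a @ [c]) - scaled_weight (j + 1) (a @ [c]) =
      q powi (- 2 * (j + 1) * (L + 1)) * (word_weight (a @ [c]) * (q powi (2 * L + 2) - 1))"
  proof -
    have "q powi (- 2 * j * (L + 1)) = q powi (- 2 * (j + 1) * (L + 1)) * q powi (2 * L + 2)"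
      unfolding powi_add[symmetric] by (rule arg_cong[where f = "\<lambda>k. q powi k"]) (simp add: algebra_simps)
    then show ?thesis unfolding scaled_weight_def by (simp add: L_def algebra_simps)
  qed
  also have "\<dots> = q powi (- 2 * (j + 1) * (L + 1)) * word_weight a * e *
      (if a \<noteq> [] \<and> precD (last a) c then q powi (2 * L) else 1)"
    unfolding W by (simp only: mult_ac)
  also have "\<dots> = letter_coeff j c * (if a \<noteq> [] \<and> precD (last a) c then scaled_weight j a else scaled_weight (j + 1) a)"
  proof -
    have 1: "q powi (- 2 * (j + 1) * (L + 1)) * q powi (2 * L) = q powi (- 2 * j - 2) * q powi (- 2 * j * L)"
      and 2: "q powi (- 2 * (j + 1) * (L + 1)) = q powi (- 2 * j - 2) * q powi (- 2 * (j + 1) * L)"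
      unfolding powi_add[symmetric]
      by (rule arg_cong[where f = "\<lambda>k. q powi k"]; simp add: algebra_simps)+
    show ?thesis
    proof (cases "a \<noteq> [] \<and> precD (last a) c")
      case True
      have "q powi (- 2 * (j + 1) * (L + 1)) * word_weight a * e * q powi (2 * L) =
          (q powi (- 2 * (j + 1) * (L + 1)) * q powi (2 * L)) * word_weight a * e"
        by (simp only: mult_ac)
      then show ?thesis
        unfolding if_P[OF True] 1 letter_coeff_def scaled_weight_def e_def L_def[symmetric]
        by (simp only: mult_ac)
    next
      case False
      show ?thesis
        unfolding if_not_P[OF False] 2 letter_coeff_def scaled_weight_def e_def L_def[symmetric]
        by (simp only: mult_ac mult_1_left mult_1_right)
    qed
  qed
  finally show ?thesis by (simp add: algebra_simps)
qed

text \<open>The invariant of the telescoping: once the factors of \<open>Ls\<close> are used,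
  precisely the words ending in a letter of \<open>Ls\<close> have reached level \<open>j\<close>.
  The next factor lifts the words ending in \<open>c\<close> by \<open>scaled_weight_snoc\<close>.
  \<open>R\<close> holds the letters still to come.\<close>

lemma mult_factors_scaled_weight:
  assumes "sorted_wrt precD (Ls @ R)" "a \<in> lists (set (Ls @ R))"
  shows "mult_factors (scaled_weight (j + 1)) (map (\<lambda>c. (c, letter_coeff j c)) Ls) a =
    (if a \<noteq> [] \<and> last a \<in> set Ls then scaled_weight j a else scaled_weight (j + 1) a)"
  using assms
proof (induction Ls arbitrary: R a rule: rev_induct)
  case (snoc c Ls)
  let ?f = "mult_factors (scaled_weight (j + 1)) (map (\<lambda>c. (c, letter_coeff j c)) Ls)"
  have IH: "?f a = (if a \<noteq> [] \<and> last a \<in> set Ls then scaled_weight j a else scaled_weight (j + 1) a)"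
    if "a \<in> lists (set (Ls @ c # R))" for a
    using snoc.IH[of "c # R" a] snoc.prems that by simp
  have step: "mult_factors (scaled_weight (j + 1)) (map (\<lambda>c. (c, letter_coeff j c)) (Ls @ [c])) a =
      ?f a + letter_coeff j c * suffix_part [c] ?f a"
    by (simp add: mult_factor_def)
  \<comment> \<open>For the strict order \<open>precD\<close>, preceding \<open>c\<close> means that
    the factor has already been used; this matches the ascent condition with the invariant.\<close>
  have prec: "precD b c \<longleftrightarrow> b \<in> set Ls" if "b \<in> set (Ls @ c # R)" for b
  proof -
    have "sorted_wrt precD (Ls @ c # R)" using snoc.prems by simp
    then have "\<forall>b\<in>set Ls. precD b c" "\<forall>b\<in>set R. precD c b"
      by (simp_all add: sorted_wrt_append)
    moreover have "\<not> precD c c" "precD c b \<Longrightarrow> \<not> precD b c" by (auto simp: precD_def)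
    ultimately show ?thesis using that by auto
  qed
  have a: "a \<in> lists (set (Ls @ c # R))" using snoc.prems by simp
  show ?case
  proof (cases "\<exists>d. a = d @ [c]")
    case True
    then obtain d where d: "a = d @ [c]" by blast
    have "c \<notin> set Ls" using prec[of c] by (auto simp: precD_def)
    moreover have "d \<in> lists (set (Ls @ c # R))" "d \<noteq> [] \<Longrightarrow> last d \<in> set (Ls @ c # R)"
      using a d by (auto simp: in_lists_conv_set)
    moreover from this have "(d \<noteq> [] \<and> precD (last d) c) \<longleftrightarrow> (d \<noteq> [] \<and> last d \<in> set Ls)"
      using prec[of "last d"] by blast
    ultimately show ?thesis unfolding step IH[OF a] unfolding d suffix_part_append
      by (simp add: IH scaled_weight_snoc[of j d c])
  next
    case False
    then have "suffix_part [c] ?f a = 0" by (intro suffix_part_zero) auto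
    moreover have "a \<noteq> [] \<Longrightarrow> last a \<noteq> c" using False by (metis append_butlast_last_id)
    ultimately show ?thesis unfolding step IH[OF a] by auto
  qed
qed simp

lemma step_factors_powi:
  "step_factors n (\<lambda>i. q powi (i - 1 - 2 * j)) =
     map (\<lambda>c. (c, letter_coeff j c)) (map uminus [1..int n - 1] @ [1..int n - 1])"
proof -
  have 1: "q powi (b - 1 - 1 - 2 * j) + q powi (- 1 - 1 - 2 * j) = letter_coeff j (- b)"
    and 2: "q powi (b - 1 - 2 * j) + q powi (0 - 1 - 2 * j) = letter_coeff j b" if "b \<ge> 1" for b
  proof -
    have "q ^ nat b = q powi b" using that by (simp add: power_int_def)
    moreover have "b - 1 - 1 - 2 * j = (- 2 * j - 2) + b" "b - 1 - 2 * j = (- 2 * j - 2) + b + 1"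
      "0 - 1 - 2 * j = (- 2 * j - 2) + 1" "- 1 - 1 - 2 * j = - 2 * j - 2" by simp_all
    then have "q powi (b - 1 - 1 - 2 * j) = q powi (- 2 * j - 2) * q powi b"
      "q powi (b - 1 - 2 * j) = q powi (- 2 * j - 2) * q powi b * q"
      "q powi (0 - 1 - 2 * j) = q powi (- 2 * j - 2) * q"
      "q powi (- 1 - 1 - 2 * j) = q powi (- 2 * j - 2)"
      by (simp_all only: powi_add power_int_1_right)
    ultimately show 
      "q powi (b - 1 - 1 - 2 * j) + q powi (- 1 - 1 - 2 * j) = letter_coeff j (- b)"
      "q powi (b - 1 - 2 * j) + q powi (0 - 1 - 2 * j) = letter_coeff j b"
      using that by (simp_all add: letter_coeff_def algebra_simps)
  qed
  show ?thesis unfolding step_factors_def map_append map_map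
    by (intro arg_cong2[where f = append] map_cong refl) (auto simp: 1[simplified] 2[simplified])
qed

lemma mult_step_factors_scaled_weight:
  assumes "a \<in> lists (lettersD n)"
  shows "mult_factors (scaled_weight (j + 1)) (step_factors n (\<lambda>i. q powi (i - 1 - 2 * j))) a =
    scaled_weight j a"
proof -
  let ?L = "map uminus [1..int n - 1] @ [1..int n - 1]"
  have "sorted_wrt precD ?L"
    unfolding sorted_wrt_append sorted_wrt_map
    by (intro conjI sorted_wrt_mono_rel[OF _ sorted_wrt_upto]) (auto simp: precD_def)
  moreover have L: "set ?L = lettersD n"
  proof (intro equalityI subsetI)
    fix b assume "b \<in> lettersD n"
    then have "b \<in> {1..int n - 1} \<or> b = uminus (- b) \<and> - b \<in> {1..int n - 1}"
      by (auto simp: lettersD_def)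
    then show "b \<in> set ?L" unfolding set_append set_map set_upto by blast
  qed (auto simp: lettersD_def)
  ultimately have "mult_factors (scaled_weight (j + 1)) (map (\<lambda>c. (c, letter_coeff j c)) ?L) a =
    (if a \<noteq> [] \<and> last a \<in> set ?L then scaled_weight j a else scaled_weight (j + 1) a)"
    using mult_factors_scaled_weight[of ?L "[]" a j] assms by simp
  also have "\<dots> = scaled_weight j a"
  \<comment> \<open>The empty word ends in no letter, but its weight is the same at every
    level.\<close>
  proof (cases "a = []")
    case False
    then have "last a \<in> lettersD n" using assms by (auto simp: in_lists_conv_set)
    then show ?thesis using False by (simp only: L) simp
  qed (simp add: scaled_weight_def)
  finally show ?thesis unfolding step_factors_powi .
qed

end

section \<open>Convergence\<close>

definition vanishes_below :: "int \<Rightarrow> 'a::field fls \<Rightarrow> bool" where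
  "vanishes_below N f \<longleftrightarrow> f = 0 \<or> N \<le> fls_subdegree f"

lemma vanishes_below_0 [simp]: "vanishes_below N 0"
  by (simp add: vanishes_below_def)

lemma vanishes_below_iff: "vanishes_below N f \<longleftrightarrow> (\<forall>k<N. fls_nth f k = 0)"
proof
  show "\<forall>k<N. fls_nth f k = 0" if "vanishes_below N f"
    using that by (auto simp: vanishes_below_def)
  show "vanishes_below N f" if "\<forall>k<N. fls_nth f k = 0"
    using that unfolding vanishes_below_def by (metis linorder_not_le nth_fls_subdegree_nonzero)
qed

lemma vanishes_below_mono: "vanishes_below N f \<Longrightarrow> N' \<le> N \<Longrightarrow> vanishes_below N' f"
  by (auto simp: vanishes_below_def)

lemma vanishes_below_add: "vanishes_below N f \<Longrightarrow> vanishes_below N g \<Longrightarrow> vanishes_below N (f + g)"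
  by (simp add: vanishes_below_iff)

lemma vanishes_below_sum: "(\<And>x. x \<in> A \<Longrightarrow> vanishes_below N (f x)) \<Longrightarrow> vanishes_below N (sum f A)"
  by (induction A rule: infinite_finite_induct) (auto intro: vanishes_below_add)

lemma vanishes_below_mult:
  "vanishes_below N f \<Longrightarrow> vanishes_below N' g \<Longrightarrow> vanishes_below (N + N') (f * g)"
  by (cases "f = 0 \<or> g = 0") (auto simp: vanishes_below_def)

lemma vanishes_below_powi: "N \<le> - k \<Longrightarrow> vanishes_below N (fls_X_inv powi k :: 'a::field fls)"
  by (simp add: vanishes_below_def)

lemma dist_less_if_vanishes_below:
  assumes "e > 0"
  obtains N where "\<And>f g. vanishes_below (int N) (f - g :: 'a::field fls) \<Longrightarrow> dist f g < e"
proof -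
  obtain N where N: "(1 / 2) ^ N < e"
    using real_arch_pow_inv[OF assms, of "1 / 2"] by auto
  show ?thesis
  proof (rule that)
    fix f g :: "'a fls" assume *: "vanishes_below (int N) (f - g)"
    show "dist f g < e"
    proof (cases "f = g")
      case False
      then have sub: "int N \<le> fls_subdegree (f - g)" using * by (simp add: vanishes_below_def)
      then have "dist f g = (1 / 2) ^ nat (fls_subdegree (f - g))"
        using False by (simp add: dist_fls_def power_one_over inverse_eq_divide)
      also have "\<dots> \<le> (1 / 2) ^ N"
        using sub by (intro power_decreasing) auto
      finally show ?thesis using N by simp
    qed (use assms in simp)
  qed
qed

lemma mult_factors_diff:
  "mult_factors (\<lambda>a. f a - g a) L a = mult_factors f L a - mult_factors g L a"
proof (induction L arbitrary: a rule: rev_induct)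
  case (snoc h L)
  obtain b x where h: "h = (b, x)" by (cases h)
  have diff: "suffix_part [b] (\<lambda>a. F a - G a) a = suffix_part [b] F a - suffix_part [b] G a"
    for F G :: "int list \<Rightarrow> 'a"
    by (simp add: suffix_part_def)
  show ?case
    unfolding h mult_factors_snoc snoc diff by (simp add: algebra_simps)
qed simp

text \<open>A factor costs at most \<open>d\<close> in order, but only when it contributes a letter.
  The loss is thus governed by the length of the word and not by the number of factors.\<close>

lemma vanishes_below_mult_factors:
  assumes "\<And>a. a \<in> lists A \<Longrightarrow> length a \<le> p \<Longrightarrow> vanishes_below (N - d * int (length a)) (f a)"
    and "\<And>h. h \<in> set L \<Longrightarrow> vanishes_below (- d) (snd h)"
    and "a \<in> lists A" "length a \<le> p"
  shows "vanishes_below (N - d * int (length a)) (mult_factors f L a)"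
  using assms(2-4)
proof (induction L arbitrary: a rule: rev_induct)
  case Nil
  then show ?case using assms(1) by simp
next
  case (snoc h L)
  have "vanishes_below (N - d * int (length a)) (snd h * suffix_part [fst h] (mult_factors f L) a)"
  proof (cases "\<exists>a'. a = a' @ [fst h]")
    case True
    then obtain a' where a': "a = a' @ [fst h]" by blast
    have "vanishes_below (- d + (N - d * int (length a'))) (snd h * mult_factors f L a')"
      using snoc by (intro vanishes_below_mult) (auto simp: a')
    moreover have "- d + (N - d * int (length a')) = N - d * int (length a)"
      by (simp add: a' algebra_simps)
    moreover have "suffix_part [fst h] (mult_factors f L) a = mult_factors f L a'"
      by (simp add: a')
    ultimately show ?thesis by (simp only:)
  next
    case False
    then have "suffix_part [fst h] (mult_factors f L) a = 0" by (intro suffix_part_zero) auto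
    then show ?thesis by simp
  qed
  moreover have "vanishes_below (N - d * int (length a)) (mult_factors f L a)"
    using snoc by auto
  ultimately have "vanishes_below (N - d * int (length a))
      (mult_factors f L a + snd h * suffix_part [fst h] (mult_factors f L) a)"
    by (intro vanishes_below_add)
  then show ?case using mult_factors_snoc[of f L "fst h" "snd h" a] by simp
qed

section \<open>Iterating the double step and estimating the error\<close>

primrec iterated_factors :: "nat \<Rightarrow> nat \<Rightarrow> (int \<Rightarrow> 'a::plus) \<Rightarrow> (int \<times> 'a) list" where
  "iterated_factors n 0 X = schubert_factors n 1 0 X"
| "iterated_factors n (Suc M) X = iterated_factors n M (\<lambda>i. X (i - 2)) @ step_factors n X"

lemma schubert_factors_iterated:
  assumes "n > 0"
  shows "nil_eqv n (schubert_factors n 1 (2 * M) X) (iterated_factors n M X)"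
proof (induction M arbitrary: X)
  case (Suc M)
  have "nil_eqv n (schubert_factors n 1 (2 * Suc M) X)
      (schubert_factors n 1 (2 * M) (\<lambda>i. X (i - 2)) @ step_factors n X)"
    using schubert_factors_Suc_Suc[OF assms] by simp
  also have "nil_eqv n \<dots> (iterated_factors n (Suc M) X)"
    by (simp add: nil_eqv_append Suc)
  finally show ?case .
qed simp

lemma q_pow_neq_1: "m > 0 \<Longrightarrow> q ^ m \<noteq> 1"
proof
  assume "m > 0" "q ^ m = 1"
  then have "fls_subdegree (q ^ m) = fls_subdegree (1 :: rat fls)" by simp
  then show False using \<open>m > 0\<close> by simp
qed

lemma step_factors_coeff:
  assumes "h \<in> set (step_factors n (\<lambda>i. q powi (i - 1 - 2 * j)))" "j \<ge> 0"
  shows "vanishes_below (- int n) (snd h)"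
  using assms by (auto simp: step_factors_def intro!: vanishes_below_add vanishes_below_powi)

text \<open>Both coefficient functions descend from level \<open>j + 1\<close> to level
  \<open>j\<close> through the same \<open>step_factors\<close>, so their difference does too. The
  induction ends at level \<open>j + M\<close>, where the error on a word of length l is the initial
  one times \<open>q^(-2(j+M)l)\<close>.\<close>

lemma iterated_factors_approx:
  assumes "n > 0" "j \<ge> 0"
    and C: "\<And>a. a \<in> lists (lettersD n) \<Longrightarrow> length a \<le> p \<Longrightarrow> vanishes_below (- C)
      (mult_factors unit_word (schubert_factors n 1 0 (\<lambda>i. q powi (i - 1))) a - word_weight q a)"
    and "a \<in> lists (lettersD n)" "length a \<le> p"
  shows "vanishes_below (2 * int M + 2 * j - C - int n * int (length a))
    (mult_factors unit_word (iterated_factors n M (\<lambda>i. q powi (i - 1 - 2 * j))) a - scaled_weight q j a)"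
  using assms(2,4,5)
proof (induction M arbitrary: j a)
  case 0
  have prod: "prod_list (map (\<lambda>i. q powi (i - 1 - 2 * j)) s) =
      q powi (- 2 * j * int (length s)) * prod_list (map (\<lambda>i. q powi (i - 1)) s)" for s
  proof (induction s)
    case (Cons i s)
    have "i - 1 - 2 * j = - 2 * j + (i - 1)"
      "- 2 * j * int (length (i # s)) = - 2 * j + - 2 * j * int (length s)" by (simp_all add: algebra_simps)
    then show ?case using Cons by (simp only: power_int_add list.map prod_list.Cons
      fls_X_inv_nonzero simp_thms mult_ac)
  qed simp
  have "mult_factors unit_word (iterated_factors n 0 (\<lambda>i. q powi (i - 1 - 2 * j))) a =
      q powi (- 2 * j * int (length a)) * mult_factors unit_word (schubert_factors n 1 0 (\<lambda>i. q powi (i - 1))) a"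
    unfolding iterated_factors.simps mult_schubert_factors[OF assms(1) 0(2)] sum_distrib_left prod
    by (intro sum.cong refl) (auto simp: compatible_def)
  then have eq: "mult_factors unit_word (iterated_factors n 0 (\<lambda>i. q powi (i - 1 - 2 * j))) a - scaled_weight q j a =
      q powi (- 2 * j * int (length a)) *
        (mult_factors unit_word (schubert_factors n 1 0 (\<lambda>i. q powi (i - 1))) a - word_weight q a)"
    using q_pow_neq_1 by (simp add: scaled_weight_def algebra_simps)
  show ?case
  \<comment> \<open>The empty word gains nothing from the scaling, but both of its coefficients are
    exactly 1. A nonempty word gains at least \<open>2 * j\<close>.\<close>
  proof (cases "a = []")
    case True
    have "word_weight q [] = 1" using q_pow_neq_1 by (simp add: word_weight_def comajD_def)
    moreover have "mult_factors unit_word (schubert_factors n 1 0 (\<lambda>i. q powi (i - 1))) [] = 1"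
    proof -
      have "s \<in> compatible [] \<and> (\<forall>i\<in>set s. 1 - int 0 \<le> i) \<longleftrightarrow> s = []" for s
        by (cases s) (simp_all add: compatible_def)
      then have "{s. s \<in> compatible [] \<and> (\<forall>i\<in>set s. 1 - int 0 \<le> i)} = {[]}"
        by (simp only: singleton_conv)
      then show ?thesis
        unfolding mult_schubert_factors[OF assms(1) lists.Nil] by (simp only:) simp
    qed
    ultimately show ?thesis unfolding eq unfolding True by (simp only: diff_self mult_zero_right vanishes_below_0)
  next
    case False
    have "vanishes_below (2 * j * int (length a) + (- C)) (q powi (- 2 * j * int (length a)) *
        (mult_factors unit_word (schubert_factors n 1 0 (\<lambda>i. q powi (i - 1))) a - word_weight q a))"
      using 0 by (intro vanishes_below_mult vanishes_below_powi C) auto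
    moreover have "2 * int 0 + 2 * j - C - int n * int (length a) \<le> 2 * j * int (length a) + - C"
    proof -
      have "2 * j * 1 \<le> 2 * j * int (length a)"
        using 0(1) False by (intro mult_left_mono) (auto simp: Suc_le_eq)
      moreover have "0 \<le> int n * int (length a)" by simp
      ultimately show ?thesis by linarith
    qed
    ultimately show ?thesis unfolding eq by (rule vanishes_below_mono)
  qed
next
  case (Suc M)
  let ?L = "step_factors n (\<lambda>i. q powi (i - 1 - 2 * j))"
  let ?f = "mult_factors unit_word (iterated_factors n M (\<lambda>i. q powi (i - 1 - 2 * (j + 1))))"
  have shift: "(\<lambda>i. q powi (i - 2 - 1 - 2 * j)) = (\<lambda>i. q powi (i - 1 - 2 * (j + 1)))"
    by (simp add: algebra_simps)
  have "mult_factors unit_word (iterated_factors n (Suc M) (\<lambda>i. q powi (i - 1 - 2 * j))) a - scaled_weight q j a =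
      mult_factors (\<lambda>a. ?f a - scaled_weight q (j + 1) a) ?L a"
    using mult_step_factors_scaled_weight[of q a n j] Suc.prems q_pow_neq_1
    unfolding mult_factors_diff iterated_factors.simps foldl_append shift by simp
  moreover have "vanishes_below (2 * int M + 2 * (j + 1) - C - int n * int (length a))
      (mult_factors (\<lambda>a. ?f a - scaled_weight q (j + 1) a) ?L a)"
  proof (rule vanishes_below_mult_factors[where A = "lettersD n" and p = p])
    show "vanishes_below (2 * int M + 2 * (j + 1) - C - int n * int (length a))
        (?f a - scaled_weight q (j + 1) a)" if "a \<in> lists (lettersD n)" "length a \<le> p" for a
      using Suc.prems(1) that by (intro Suc.IH) auto
    show "vanishes_below (- int n) (snd h)" if "h \<in> set ?L" for h
      using that Suc.prems(1) by (rule step_factors_coeff)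
  qed (use Suc.prems in auto)
  moreover have "2 * int M + 2 * (j + 1) = 2 * int (Suc M) + 2 * j" by simp
  ultimately show ?case by (simp only:)
qed

lemma vanishes_below_finite:
  assumes "finite A"
  shows "\<exists>C. \<forall>x\<in>A. vanishes_below (- C) (f x)"
proof (intro exI[of _ "- Min ((\<lambda>x. fls_subdegree (f x)) ` A)"] ballI)
  fix x assume "x \<in> A"
  then show "vanishes_below (- (- Min ((\<lambda>x. fls_subdegree (f x)) ` A))) (f x)"
    using assms by (auto simp: vanishes_below_def)
qed

text \<open>The recursion transforms the truncated series into iterated steps, whose error is known
  word by word. \<open>K\<close> is independent of \<open>M\<close> because all reduced words have
  one length.\<close>

lemma red_sum_schubert_approx:
  assumes "n > 0"
  shows "\<exists>K. \<forall>M. vanishes_below (2 * int M - K)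
    ((\<Sum>a\<in>reducedD n w. \<Sum>s | s \<in> compatible a \<and> (\<forall>i\<in>set s. 1 - 2 * int M \<le> i).
        prod_list (map (\<lambda>i. q powi (i - 1)) s)) - (\<Sum>a\<in>reducedD n w. word_weight q a))"
proof -
  obtain p where p: "\<And>a. a \<in> reducedD n w \<Longrightarrow> length a = p"
    using length_reducedD by blast
  \<comment> \<open>Only finitely many words have length at most \<open>p\<close>, so the initial
    errors have a common lower bound on their orders.\<close>
  obtain C where C: "\<And>a. a \<in> lists (lettersD n) \<Longrightarrow> length a \<le> p \<Longrightarrow> vanishes_below (- C)
      (mult_factors unit_word (schubert_factors n 1 0 (\<lambda>i. q powi (i - 1))) a - word_weight q a)"
    using vanishes_below_finite[OF finite_lists_length_le[OF finite_lettersD[of n], of p]]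
    by (fastforce simp: subset_iff)
  have red: "a \<in> lists (lettersD n)" if "a \<in> reducedD n w" for a
    using that by (simp add: reducedD_def)
  show ?thesis
  proof (intro exI allI)
    fix M
    let ?S = "schubert_factors n 1 (2 * M) (\<lambda>i. q powi (i - 1))"
    let ?I = "iterated_factors n M (\<lambda>i. q powi (i - 1))"
    have "(\<Sum>a\<in>reducedD n w. \<Sum>s | s \<in> compatible a \<and> (\<forall>i\<in>set s. 1 - 2 * int M \<le> i).
        prod_list (map (\<lambda>i. q powi (i - 1)) s)) = red_sum n (mult_factors unit_word ?S) w"
      unfolding red_sum_def by (intro sum.cong refl) (simp add: mult_schubert_factors[OF assms red])
    also have "\<dots> = red_sum n (mult_factors unit_word ?I) w"
      using schubert_factors_iterated[OF assms, of M "\<lambda>i. q powi (i - 1)"] by (simp add: nil_eqv_def)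
    finally have "(\<Sum>a\<in>reducedD n w. \<Sum>s | s \<in> compatible a \<and> (\<forall>i\<in>set s. 1 - 2 * int M \<le> i).
        prod_list (map (\<lambda>i. q powi (i - 1)) s)) - (\<Sum>a\<in>reducedD n w. word_weight q a) =
        (\<Sum>a\<in>reducedD n w. mult_factors unit_word ?I a - word_weight q a)"
      by (simp add: red_sum_def sum_subtractf)
    moreover have "vanishes_below (2 * int M - (C + int n * int p)) (mult_factors unit_word ?I a - word_weight q a)"
      if "a \<in> reducedD n w" for a
      using iterated_factors_approx[OF assms order.refl C red[OF that], of p M] p[OF that] q_pow_neq_1
      by (simp add: scaled_weight_def algebra_simps)
    ultimately show "vanishes_below (2 * int M - (C + int n * int p))
      ((\<Sum>a\<in>reducedD n w. \<Sum>s | s \<in> compatible a \<and> (\<forall>i\<in>set s. 1 - 2 * int M \<le> i).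
        prod_list (map (\<lambda>i. q powi (i - 1)) s)) - (\<Sum>a\<in>reducedD n w. word_weight q a))"
      by (simp add: vanishes_below_sum)
  qed
qed

section \<open>Orders of the monomials and summability\<close>

lemma vanishes_below_prod_list:
  assumes "\<And>i. i \<in> set s \<Longrightarrow> i \<le> int n"
  shows "vanishes_below (- int n * int (length s)) (prod_list (map (\<lambda>i. q powi (i - 1)) s))"
  using assms
proof (induction s)
  case (Cons i s)
  have i: "- int n \<le> - (i - 1)" using Cons.prems[of i] by simp
  have "vanishes_below (- int n + - int n * int (length s))
      (q powi (i - 1) * prod_list (map (\<lambda>i. q powi (i - 1)) s))"
    using Cons.IH Cons.prems i by (intro vanishes_below_mult vanishes_below_powi) auto
  then show ?case by (simp add: algebra_simps)
qed (simp add: vanishes_below_def)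

text \<open>A very negative index contributes order at least \<open>N\<close>, while each other
  position costs at most \<open>n\<close>. This makes the tail of the series small.\<close>

lemma vanishes_below_prod_list_small_index:
  assumes "\<And>i. i \<in> set s \<Longrightarrow> i \<le> int n" "k \<in> set s" "k \<le> - N"
  shows "vanishes_below (N - int n * int (length s)) (prod_list (map (\<lambda>i. q powi (i - 1)) s))"
proof -
  obtain xs ys where s: "s = xs @ k # ys" using assms(2) by (meson split_list)
  have "vanishes_below (- int n * int (length xs) + (N + - int n * int (length ys)))
    (prod_list (map (\<lambda>i. q powi (i - 1)) xs) * (q powi (k - 1) * prod_list (map (\<lambda>i. q powi (i - 1)) ys)))"
    using assms by (intro vanishes_below_mult vanishes_below_powi vanishes_below_prod_list) (auto simp: s)
  then have "vanishes_below (- int n * int (length xs) + (N + - int n * int (length ys)))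
      (prod_list (map (\<lambda>i. q powi (i - 1)) s))"
    by (simp add: s)
  then show ?thesis by (rule vanishes_below_mono) (simp add: s algebra_simps)
qed

lemma compatible_le:
  assumes "s \<in> compatible a" "a \<in> lists (lettersD n)" "n > 0" "i \<in> set s"
  shows "i \<le> int n"
proof -
  obtain j where j: "j < length s" "s ! j = i" using assms(4) by (auto simp: in_set_conv_nth)
  then have "a ! j \<in> lettersD n" "0 < i \<longrightarrow> i \<le> a ! j"
    using assms by (auto simp: compatible_def in_lists_conv_set)
  then show ?thesis by (auto simp: lettersD_def)
qed

lemma schubertD_monomial:
  fixes v :: "int \<Rightarrow> 'a::comm_ring_1"
  shows "of_int (schubertD n w m) * (\<Prod>i\<in>#m. v i) =
    (\<Sum>a\<in>reducedD n w. \<Sum>s | s \<in> compatible a \<and> mset s = m. prod_list (map v s))"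
proof -
  have "(\<Sum>s | s \<in> compatible a \<and> mset s = m. prod_list (map v s)) =
      of_nat (card {s \<in> compatible a. mset s = m}) * (\<Prod>i\<in>#m. v i)" for a
  proof -
    have "prod_list (map v s) = (\<Prod>i\<in>#m. v i)" if "mset s = m" for s
      unfolding that[symmetric] by (metis mset_map prod_mset_prod_list)
    then show ?thesis by simp
  qed
  then show ?thesis by (simp add: schubertD_def sum_distrib_right)
qed

theorem theorem1p11:
  fixes n :: nat and w :: "int \<Rightarrow> int"
  assumes "n > 0" and "w \<in> WD n"
  shows "specializes_to (schubertD n w) (\<lambda>i. q powi (i - 1))
    (\<Sum>a\<in>reducedD n w.
       (\<Prod>b\<leftarrow>a. (q ^ nat \<bar>b\<bar> + 1)) / (\<Prod>j=1..length a. (q ^ (2 * j) - 1)) * q ^ comajD a)"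
proof -
  let ?R = "reducedD n w"
  let ?P = "\<lambda>s. prod_list (map (\<lambda>i. q powi (i - 1)) s)"
  define B where "B M a = {s. s \<in> compatible a \<and> (\<forall>i\<in>set s. 1 - 2 * int M \<le> i)}" for M a
  define T where "T m = of_int (schubertD n w m) * (\<Prod>i\<in>#m. q powi (i - 1))" for m
  define S where "S = (\<Sum>a\<in>?R. word_weight q a)"
  have T: "T m = (\<Sum>a\<in>?R. \<Sum>s | s \<in> compatible a \<and> mset s = m. ?P s)" for m
    unfolding T_def by (rule schubertD_monomial)
  have red: "a \<in> lists (lettersD n)" if "a \<in> ?R" for a
    using that by (simp add: reducedD_def)
  obtain p where p: "\<And>a. a \<in> ?R \<Longrightarrow> length a = p"
    using length_reducedD by blast
  obtain K where K: "\<And>M. vanishes_below (2 * int M - K) ((\<Sum>a\<in>?R. \<Sum>s\<in>B M a. ?P s) - S)"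
    unfolding B_def S_def using red_sum_schubert_approx[OF assms(1), of w] by blast
  have finB: "finite (B M a)" if "a \<in> ?R" for M a
    unfolding B_def using finite_bounded_compatible[OF assms(1) red[OF that], of "2 * M"] by simp
  \<comment> \<open>The finite set of monomials that controls the unordered sum. The lower bound on
    indices depends only on the multiset, so each of these monomials collects all of its compatible
    sequences inside \<open>B M a\<close>.\<close>
  define F0 where "F0 M = (\<Union>a\<in>?R. mset ` B M a)" for M
  have finF0: "finite (F0 M)" for M
    unfolding F0_def using finB by (simp add: finite_reducedD)
  have sumF0: "(\<Sum>m\<in>F0 M. T m) = (\<Sum>a\<in>?R. \<Sum>s\<in>B M a. ?P s)" for M
  proof -
    have "(\<Sum>m\<in>F0 M. \<Sum>s | s \<in> compatible a \<and> mset s = m. ?P s) = (\<Sum>s\<in>B M a. ?P s)" if "a \<in> ?R" for a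
    proof -
      have "{s. s \<in> compatible a \<and> mset s = m} = {s. s \<in> B M a \<and> mset s = m}" if "m \<in> F0 M" for m
      proof -
        have "\<forall>i\<in>#m. 1 - 2 * int M \<le> i" using that by (auto simp: F0_def B_def)
        then show ?thesis by (auto simp: B_def)
      qed
      then have "(\<Sum>m\<in>F0 M. \<Sum>s | s \<in> compatible a \<and> mset s = m. ?P s) =
          (\<Sum>m\<in>F0 M. \<Sum>s | s \<in> B M a \<and> mset s = m. ?P s)" by simp
      also have "\<dots> = (\<Sum>s\<in>B M a. ?P s)"
        using that finB finF0 by (intro sum.group) (auto simp: F0_def)
      finally show ?thesis .
    qed
    then show ?thesis unfolding T by (subst sum.swap) simp
  qed
  have small: "vanishes_below (2 * int M - int n * int p) (T m)" if m: "m \<notin> F0 M" for M m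
    unfolding T
  proof (intro vanishes_below_sum)
    fix a s assume a: "a \<in> ?R" and s: "s \<in> {s. s \<in> compatible a \<and> mset s = m}"
    then have "s \<notin> B M a" using m by (auto simp: F0_def)
    then obtain k where "k \<in> set s" "k \<le> - (2 * int M)" using s by (force simp: B_def)
    moreover have "length s = p" using s p[OF a] by (auto simp: compatible_def)
    moreover have "i \<le> int n" if "i \<in> set s" for i
      using s compatible_le[OF _ red[OF a] assms(1) that] by simp
    ultimately show "vanishes_below (2 * int M - int n * int p) (?P s)"
      using vanishes_below_prod_list_small_index[of s n k "2 * int M"] by simp
  qed
  have "(T has_sum S) UNIV"
    unfolding has_sum_def tendsto_iff eventually_finite_subsets_at_top
  proof (intro allI impI)
    fix e :: real assume "e > 0"
    then obtain N where N: "\<And>f g. vanishes_below (int N) (f - g :: rat fls) \<Longrightarrow> dist f g < e"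
      using dist_less_if_vanishes_below by blast
    \<comment> \<open>Large enough that both the error of the truncated sum and every term outside
      \<open>F0 M\<close> have order at least \<open>N\<close>.\<close>
    define M where "M = nat (int N + \<bar>K\<bar> + int n * int p)"
    have M: "int N \<le> 2 * int M - K" "int N \<le> 2 * int M - int n * int p"
    proof -
      have "int M = int N + \<bar>K\<bar> + int n * int p" "0 \<le> int n * int p" unfolding M_def by simp_all
      then show "int N \<le> 2 * int M - K" "int N \<le> 2 * int M - int n * int p" by linarith+
    qed
    have "dist (sum T F) S < e" if "finite F" "F0 M \<subseteq> F" for F
    proof (rule N)
      \<comment> \<open>The order of a sum is bounded below by the orders of its terms, so the size
        of \<open>F - F0 M\<close> has no influence on the estimate.\<close>
      have "sum T F - S = ((\<Sum>m\<in>F0 M. T m) - S) + sum T (F - F0 M)"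
        using sum.subset_diff[OF that(2,1), of T] by simp
      also have "vanishes_below (int N) \<dots>"
      proof (rule vanishes_below_add)
        show "vanishes_below (int N) (sum T (F0 M) - S)"
          unfolding sumF0 using K M(1) by (rule vanishes_below_mono)
        show "vanishes_below (int N) (sum T (F - F0 M))"
          by (intro vanishes_below_sum vanishes_below_mono[OF small M(2)]) auto
      qed
      finally show "vanishes_below (int N) (sum T F - S)" .
    qed
    then show "\<exists>X. finite X \<and> X \<subseteq> UNIV \<and>
        (\<forall>Y. finite Y \<and> X \<subseteq> Y \<and> Y \<subseteq> UNIV \<longrightarrow> dist (sum T Y) S < e)"
      using finF0[of M] by blast
  qed
  moreover have "S = (\<Sum>a\<in>?R.
       (\<Prod>b\<leftarrow>a. (q ^ nat \<bar>b\<bar> + 1)) / (\<Prod>j=1..length a. (q ^ (2 * j) - 1)) * q ^ comajD a)"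
    unfolding S_def using q_pow_neq_1 by (simp add: word_weight_def)
  ultimately show ?thesis unfolding specializes_to_def T_def by simp
qed

end
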